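(* Let $M$ be a loopless matroid of rank $r = d+1$ on a finite ground set $E$. Let $\emptyset = F_0 \subsetneq F_1 \subsetneq \cdots \subsetneq F_k \subsetneq F_{k+1} = E$ be a chain of flats of $M$ with ranks $r_i := \operatorname{rk}_M F_i$, and let $d_1, \ldots, d_k$ be positive integers such that $\sum_{i=1}^k d_i = d$. Put $\widetilde d_i := \sum_{j=1}^i d_j$. Then $$\deg_M(x_{F_1}^{d_1}\cdots x_{F_k}^{d_k}) = (-1)^{d-k} \prod_{i = 1}^{k}\binom{d_i -1}{\widetilde d_i - r_i}\,\mu^{\widetilde d_i - r_i}(M|F_{i+1}/F_i).$$
   Context: For a loopless matroid $M$ on $E$ (i.e. $\emptyset$ is a flat), $\mathscr L_M$ is the lattice of flats and $\overline{\mathscr L_M} := \mathscr L_M\setminus\{\emptyset,E\}$. The Chow ring of $M$ is the graded ring $$A^\bullet(M) := \mathbb R[x_F : F\in \overline{\mathscr L_M}]/(\mathcal I_M+\mathcal J_M),$$ where $\mathcal I_M = (x_Fx_{F'} : F,F' \text{ incomparable})$ and $\mathcal J_M = (\sum_{F\ni i}x_F - \sum_{G\ni j}x_G : i,j\in E)$, sums over flats in $\overline{\mathscr L_M}$. If $M$ has rank $d+1$, then (known theorem of Adiprasito–Huh–Katz) there is a unique linear isomorphism $\deg_M: A^d(M)\to\mathbb R$ with $\deg_M(x_{G_1}x_{G_2}\cdots x_{G_d})=1$ for every maximal chain $G_1\subsetneq\cdots\subsetneq G_d$ in $\overline{\mathscr L_M}$. $M|F'/F$ denotes the restriction of $M$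 to $F'$ followed by the contraction of $F$. For a loopless matroid $M'$ of rank at least $1$, the characteristic polynomial is $\chi_{M'}(t)=\sum_{G\in\mathscr L_{M'}}\mu(\emptyset,G)t^{\operatorname{rk}M'-\operatorname{rk}G}$ ($\mu(\cdot,\cdot)$ the Möbius function of $\mathscr L_{M'}$), the reduced characteristic polynomial is $\overline\chi_{M'}(t)=\chi_{M'}(t)/(t-1)$, and $\mu^i(M')$ is its $i$-th unsigned coefficient: $$\overline{\chi}_{M'}(t) = \mu^0(M') t^{\operatorname{rk} M'-1} - \mu^1(M') t^{\operatorname{rk}M'-2} + \cdots + (-1)^{\operatorname{rk}M' -1}\mu^{\operatorname{rk}M'-1}(M'),$$ with $\mu^i(M')=0$ for $i$ outside $0\le i\le \operatorname{rk}M'-1$. A binomial coefficient $\binom nm$ is zero if $m<0$ or $m>n$. *)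

theory Defs
  imports
    "HOL-Library.Poly_Mapping"
    "HOL-Computational_Algebra.Polynomial"
    "HOL-Algebra.QuotRing"
begin

section \<open>Matroids\<close>

record 'a matroid_data =
  ground :: "'a set"
  indep :: "'a set \<Rightarrow> bool"

locale matroid =
  fixes M :: "'a matroid_data"
  assumes finite_ground: "finite (ground M)"
    and indep_subset_ground: "indep M X \<Longrightarrow> X \<subseteq> ground M"
    and indep_empty: "indep M {}"
    and indep_mono: "indep M X \<Longrightarrow> Y \<subseteq> X \<Longrightarrow> indep M Y"
    and indep_augment: "indep M X \<Longrightarrow> indep M Y \<Longrightarrow> card X < card Y \<Longrightarrow>
          \<exists>y\<in>Y - X. indep M (insert y X)"

definition rk :: "'a matroid_data \<Rightarrow> 'a set \<Rightarrow> nat" where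
  "rk M A = Max (card ` {X. X \<subseteq> A \<and> indep M X})"

definition matroid_rank :: "'a matroid_data \<Rightarrow> nat" where
  "matroid_rank M = rk M (ground M)"

definition flats :: "'a matroid_data \<Rightarrow> 'a set set" where
  "flats M = {F. F \<subseteq> ground M \<and> (\<forall>x\<in>ground M - F. rk M F < rk M (insert x F))}"

definition proper_flats :: "'a matroid_data \<Rightarrow> 'a set set" where
  "proper_flats M = flats M - {{}, ground M}"

definition loopless :: "'a matroid_data \<Rightarrow> bool" where
  "loopless M \<longleftrightarrow> {} \<in> flats M"

definition restriction :: "'a matroid_data \<Rightarrow> 'a set \<Rightarrow> 'a matroid_data" where
  "restriction M S = \<lparr>ground = S, indep = (\<lambda>X. X \<subseteq> S \<and> indep M X)\<rparr>"

text \<open>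
  The contraction is the matroid on the complement of \<open>T\<close> with rank function
  \<open>A \<mapsto> rk M (A \<union> T) - rk M T\<close>; a set is independent iff that rank is its cardinality.
\<close>

definition contraction :: "'a matroid_data \<Rightarrow> 'a set \<Rightarrow> 'a matroid_data" where
  "contraction M T = \<lparr>ground = ground M - T,
     indep = (\<lambda>X. X \<subseteq> ground M - T \<and> rk M (X \<union> T) = card X + rk M T)\<rparr>"

text \<open>The minor \<open>M|F'/F\<close>; the upper flat \<open>F'\<close> is the second argument, as in the notation.\<close>

definition minor :: "'a matroid_data \<Rightarrow> 'a set \<Rightarrow> 'a set \<Rightarrow> 'a matroid_data" where
  "minor M F' F = contraction (restriction M F') F"


section \<open>The reduced characteristic polynomial\<close>

text \<open>
  The Moebius function of a family \<open>L\<close> of sets ordered by inclusion.  Finiteness of \<open>B\<close> is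
  there only to make the recursion terminate; flats of a matroid are finite.
\<close>

function moebius :: "'a set set \<Rightarrow> 'a set \<Rightarrow> 'a set \<Rightarrow> int" where
  "moebius L A B =
     (if A = B then 1
      else if finite B \<and> A \<subset> B then - (\<Sum>C\<in>{C \<in> L. A \<subseteq> C \<and> C \<subset> B}. moebius L A C)
      else 0)"
  by pat_completeness auto
termination
  by (relation "inv_image finite_psubset (\<lambda>(L, A, B). B)")
     (use wf_finite_psubset in \<open>auto simp: finite_psubset_def\<close>)

declare moebius.simps [simp del]

definition char_poly :: "'a matroid_data \<Rightarrow> int poly" where
  "char_poly M = (\<Sum>G\<in>flats M. monom (moebius (flats M) {} G) (matroid_rank M - rk M G))"

text \<open>For a loopless matroid of positive rank the division by \<open>t - 1\<close> is exact.\<close>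

definition reduced_char_poly :: "'a matroid_data \<Rightarrow> int poly" where
  "reduced_char_poly M = char_poly M div [:-1, 1:]"

definition unsigned_coeff :: "int \<Rightarrow> 'a matroid_data \<Rightarrow> int" where
  "unsigned_coeff i M =
     (if 0 \<le> i \<and> i \<le> int (matroid_rank M) - 1
      then (-1) ^ nat i * coeff (reduced_char_poly M) (matroid_rank M - 1 - nat i)
      else 0)"

definition binom :: "int \<Rightarrow> int \<Rightarrow> int" where
  "binom n m = (if 0 \<le> m \<and> m \<le> n then int (nat n choose nat m) else 0)"


section \<open>The Chow ring\<close>

text \<open>
  Polynomials with real coefficients in variables indexed by sets: a monomial is a finitely
  supported exponent function, a polynomial a finitely supported function on monomials.
\<close>

type_synonym 'a chow_poly = "('a set \<Rightarrow>\<^sub>0 nat) \<Rightarrow>\<^sub>0 real"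

definition var :: "'a set \<Rightarrow> 'a chow_poly" where
  "var F = Poly_Mapping.single (Poly_Mapping.single F 1) 1"

definition const :: "real \<Rightarrow> 'a chow_poly" where
  "const c = Poly_Mapping.single 0 c"

definition poly_ring :: "'a matroid_data \<Rightarrow> 'a chow_poly ring" where
  "poly_ring M = \<lparr>carrier = {p. \<forall>m\<in>Poly_Mapping.keys p. Poly_Mapping.keys m \<subseteq> proper_flats M},
     mult = (*), one = 1, zero = 0, add = (+)\<rparr>"

definition incomparable_gens :: "'a matroid_data \<Rightarrow> 'a chow_poly set" where
  "incomparable_gens M =
     {var F * var F' | F F'. F \<in> proper_flats M \<and> F' \<in> proper_flats M
                              \<and> \<not> F \<subseteq> F' \<and> \<not> F' \<subseteq> F}"

definition linear_gens :: "'a matroid_data \<Rightarrow> 'a chow_poly set" where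
  "linear_gens M =
     {(\<Sum>F\<in>{F \<in> proper_flats M. i \<in> F}. var F) - (\<Sum>G\<in>{G \<in> proper_flats M. j \<in> G}. var G)
       | i j. i \<in> ground M \<and> j \<in> ground M}"

definition chow_ideal :: "'a matroid_data \<Rightarrow> 'a chow_poly set" where
  "chow_ideal M =
     Idl\<^bsub>poly_ring M\<^esub> (incomparable_gens M) <+>\<^bsub>poly_ring M\<^esub> Idl\<^bsub>poly_ring M\<^esub> (linear_gens M)"

definition chow_ring :: "'a matroid_data \<Rightarrow> 'a chow_poly set ring" where
  "chow_ring M = poly_ring M Quot chow_ideal M"

definition chow_class :: "'a matroid_data \<Rightarrow> 'a chow_poly \<Rightarrow> 'a chow_poly set" where
  "chow_class M p = chow_ideal M +>\<^bsub>poly_ring M\<^esub> p"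

abbreviation chow_var :: "'a matroid_data \<Rightarrow> 'a set \<Rightarrow> 'a chow_poly set" where
  "chow_var M F \<equiv> chow_class M (var F)"

definition homogeneous :: "nat \<Rightarrow> 'a chow_poly \<Rightarrow> bool" where
  "homogeneous n p \<longleftrightarrow>
     (\<forall>m\<in>Poly_Mapping.keys p. (\<Sum>F\<in>Poly_Mapping.keys m. Poly_Mapping.lookup m F) = n)"

definition chow_graded :: "'a matroid_data \<Rightarrow> nat \<Rightarrow> 'a chow_poly set set" where
  "chow_graded M n = chow_class M ` {p \<in> carrier (poly_ring M). homogeneous n p}"

text \<open>
  \<open>is_degree_map M deg\<close>: on the top graded piece, of degree \<open>d = matroid_rank M - 1\<close>,
  \<open>deg\<close> is a linear isomorphism onto the reals taking the value one at the product over every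
  maximal chain of proper flats.  A strict chain of \<open>d\<close> proper flats is automatically maximal,
  and all maximal chains have this length.  By a theorem of Adiprasito, Huh and Katz
  such a map exists for every loopless matroid of positive rank and is unique
  on the top graded piece; its values elsewhere are irrelevant.
\<close>

definition is_degree_map :: "'a matroid_data \<Rightarrow> ('a chow_poly set \<Rightarrow> real) \<Rightarrow> bool" where
  "is_degree_map M deg \<longleftrightarrow>
     (let A = chow_ring M; d = matroid_rank M - 1; A\<^sub>d = chow_graded M d in
       bij_betw deg A\<^sub>d UNIV \<and>
       (\<forall>a\<in>A\<^sub>d. \<forall>b\<in>A\<^sub>d. deg (a \<oplus>\<^bsub>A\<^esub> b) = deg a + deg b) \<and>
       (\<forall>c. \<forall>a\<in>A\<^sub>d. deg (chow_class M (const c) \<otimes>\<^bsub>A\<^esub> a) = c * deg a) \<and>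
       (\<forall>G :: nat \<Rightarrow> 'a set.
          (\<forall>i\<in>{1..d}. G i \<in> proper_flats M) \<and> (\<forall>i\<in>{1..<d}. G i \<subset> G (i + 1)) \<longrightarrow>
          deg (\<Otimes>\<^bsub>A\<^esub>i\<in>{1..d}. chow_var M (G i)) = 1))"

end

theory Submission
  imports Defs
begin

text \<open>
  For flats \<open>F \<subset> F'\<close> let \<open>\<alpha>\<close> and \<open>\<beta>\<close> be the sums of the variables of the flats strictly between
  \<open>F\<close> and \<open>F'\<close> which contain, respectively avoid, a point of \<open>F' - F\<close>.  After multiplication
  by the variables of \<open>F\<close> and \<open>F'\<close> neither depends on the point, and a variable in a chain
  satisfies \<open>x = - (\<alpha> + \<beta>)\<close>, with \<open>\<alpha>\<close> from the interval below and \<open>\<beta>\<close> from the interval above.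
  Substituting this into all but one factor of each power and expanding turns the monomial into a
  sum of products of \<open>\<alpha> ^ a * \<beta> ^ b\<close> over the intervals of the chain.  Such a factor vanishes if
  \<open>a + b\<close> is at least the rank of the interval, so for degree reasons only one summand can survive;
  if \<open>a + b\<close> is one less, the factor is the \<open>b\<close>-th unsigned coefficient of the reduced
  characteristic polynomial of the interval times \<open>\<alpha> ^ (a + b)\<close>, by Weisner's identity for the
  Moebius function.  Finally, the powers of \<open>\<alpha>\<close> combine to a full flag of flats.
\<close>

section \<open>Rank and flats\<close>

text \<open>The obstacle is that the intervals of the chain have to be treated separately although
  only relations on all of M are given. One could pass to a tensor product of Chow rings of minors;
  instead, multiplying by the variables of a chain kills every variable incomparable with a member
  of the chain, so each interval behaves as if it had a Chow ring of its own while all computation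
  stays in one ring. The shape of the formula comes from solving the degree balance. Suppose
  \<open>g i\<close> of the \<open>e i - 1\<close> substituted copies of the variable of
  \<open>F i\<close> contribute \<beta>, which lives on the interval above, and the others \<alpha>,
  which lives on the interval below. The interval from \<open>F i\<close> to
  \<open>F (i + 1)\<close> then carries \<open>g i\<close> factors \<beta> and
  \<open>e (i + 1) - 1 - g (i + 1)\<close> factors \<alpha>. Asking for a total of one less than its
  rank and solving from the bottom up gives \<open>g i = e 1 + ... + e i - rk M (F i)\<close>. This
  is the index of the coefficient, the binomial counts the choices of the copies, and the sign
  counts the \<open>d - k\<close> substitutions.\<close>

context matroid
begin

lemma finite_indep_subsets: "finite {X. X \<subseteq> A \<and> indep M X}"
  by (rule finite_subset[of _ "Pow (ground M)"]) (use indep_subset_ground finite_ground in auto)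

lemma finite_indep: "indep M X \<Longrightarrow> finite X"
  using indep_subset_ground finite_ground finite_subset by blast

lemma card_le_rk: "X \<subseteq> A \<Longrightarrow> indep M X \<Longrightarrow> card X \<le> rk M A"
  unfolding rk_def by (rule Max_ge) (use finite_indep_subsets in auto)

lemma rk_le_if: "(\<And>X. X \<subseteq> A \<Longrightarrow> indep M X \<Longrightarrow> card X \<le> n) \<Longrightarrow> rk M A \<le> n"
  unfolding rk_def using indep_empty finite_indep_subsets by (subst Max_le_iff) auto

lemma basis_exists: obtains B where "B \<subseteq> A" "indep M B" "card B = rk M A"
proof -
  have "rk M A \<in> card ` {X. X \<subseteq> A \<and> indep M X}"
    unfolding rk_def using indep_empty finite_indep_subsets by (intro Max_in) auto
  then show thesis using that by auto
qed

lemma rk_mono: "A \<subseteq> B \<Longrightarrow> rk M A \<le> rk M B"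
  by (rule rk_le_if) (meson card_le_rk subset_trans)

lemma rk_empty [simp]: "rk M {} = 0"
  using rk_le_if[of "{}" 0] by auto

lemma basis_extend:
  assumes "B \<subseteq> A" "indep M B"
  obtains B' where "B \<subseteq> B'" "B' \<subseteq> A" "indep M B'" "card B' = rk M A"
proof -
  have "\<exists>B'. B \<subseteq> B' \<and> B' \<subseteq> A \<and> indep M B' \<and> card B' = rk M A"
    using assms
  proof (induction "rk M A - card B" arbitrary: B rule: less_induct)
    case less
    show ?case
    proof (cases "card B = rk M A")
      case True
      then show ?thesis using less.prems by blast
    next
      case False
      then have lt: "card B < rk M A" using card_le_rk less.prems by (simp add: le_neq_implies_less)
      obtain D where D: "D \<subseteq> A" "indep M D" "card D = rk M A" by (rule basis_exists)
      then obtain y where y: "y \<in> D - B" "indep M (insert y B)"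
        using indep_augment[of B D] less.prems lt by auto
      have "rk M A - card (insert y B) < rk M A - card B"
        using y finite_indep[OF less.prems(2)] lt by auto
      then obtain B' where "insert y B \<subseteq> B'" "B' \<subseteq> A" "indep M B'" "card B' = rk M A"
        using less.hyps[of "insert y B"] y D(1) lt less.prems(1) by blast
      then show ?thesis by auto
    qed
  qed
  then show thesis using that by blast
qed

lemma rk_insert_le: "rk M (insert x A) \<le> rk M A + 1"
proof (rule rk_le_if)
  fix X assume X: "X \<subseteq> insert x A" "indep M X"
  have "indep M (X - {x})" using X indep_mono by blast
  then have "card (X - {x}) \<le> rk M A" using X card_le_rk[of "X - {x}" A] by auto
  then show "card X \<le> rk M A + 1" using finite_indep[OF X(2)] card_Diff_singleton[of x X]
    by (cases "x \<in> X") auto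
qed

text \<open>Closure is monotone. A basis of A extends to one of B; an element augmenting the latter
  can only be x, and then x would augment the basis of A as well.\<close>

lemma rk_insert_eq_mono:
  assumes "A \<subseteq> B" "rk M (insert x A) = rk M A"
  shows "rk M (insert x B) = rk M B"
proof (rule ccontr)
  assume "rk M (insert x B) \<noteq> rk M B"
  then have gt: "rk M B < rk M (insert x B)"
    using rk_mono[of B "insert x B"] by (simp add: le_neq_implies_less subset_insertI)
  obtain D where D: "D \<subseteq> A" "indep M D" "card D = rk M A" by (rule basis_exists)
  obtain D' where D': "D \<subseteq> D'" "D' \<subseteq> B" "indep M D'" "card D' = rk M B"
    using basis_extend[of D B] D assms by auto
  obtain X where X: "X \<subseteq> insert x B" "indep M X" "card X = rk M (insert x B)"
    by (rule basis_exists)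
  obtain y where y: "y \<in> X - D'" "indep M (insert y D')"
    using indep_augment[of D' X] D' X gt by auto
  have "y \<notin> B"
    using card_le_rk[of "insert y D'" B] y D' finite_indep[OF D'(3)] by auto
  then have "y = x" using y X by auto
  then have "indep M (insert x D)" "x \<notin> D" using y D' indep_mono by blast+
  then show False
    using card_le_rk[of "insert x D" "insert x A"] D finite_indep[OF D(2)] assms(2) by auto
qed

lemma flats_subset: "F \<in> flats M \<Longrightarrow> F \<subseteq> ground M"
  by (simp add: flats_def)

lemma finite_flats: "finite (flats M)"
  using finite_ground flats_subset by (intro finite_subset[of "flats M" "Pow (ground M)"]) auto

lemma finite_flat: "F \<in> flats M \<Longrightarrow> finite F"
  using finite_subset[OF flats_subset finite_ground] .

lemma rk_insert_outside_flat:
  assumes "F \<in> flats M" "A \<subseteq> F" "x \<in> ground M - F"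
  shows "rk M A < rk M (insert x A)"
proof -
  have "rk M F < rk M (insert x F)" using assms by (auto simp: flats_def)
  then have "rk M (insert x A) \<noteq> rk M A" using rk_insert_eq_mono[OF assms(2), of x] by auto
  then show ?thesis using rk_mono[of A "insert x A"] by (simp add: le_neq_implies_less subset_insertI)
qed

lemma rk_strict_mono:
  assumes "F \<in> flats M" "F' \<in> flats M" "F \<subset> F'"
  shows "rk M F < rk M F'"
proof -
  obtain x where "x \<in> F'" "x \<notin> F" using assms by auto
  then have "rk M F < rk M (insert x F)"
    using rk_insert_outside_flat[of F F x] assms flats_subset[of F'] by blast
  also have "\<dots> \<le> rk M F'" using assms \<open>x \<in> F'\<close> by (intro rk_mono) auto
  finally show ?thesis .
qed

lemma ground_flat: "ground M \<in> flats M"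
  by (auto simp: flats_def)

text \<open>The closure of \<open>insert j F\<close>. For a flat F and a point j outside it, this is
  the join of F with j and the only flat of rank \<open>rk M F + 1\<close> containing both.\<close>

definition cover :: "'a set \<Rightarrow> 'a \<Rightarrow> 'a set" where
  "cover F j = {x \<in> ground M. rk M (insert x (insert j F)) = rk M (insert j F)}"

context
  fixes F j assumes F: "F \<in> flats M" and j: "j \<in> ground M - F"
begin

lemma cover_superset: "insert j F \<subseteq> cover F j"
  using F j flats_subset by (auto simp: cover_def insert_absorb)

lemma rk_cover: "rk M (cover F j) = rk M F + 1"
proof -
  have ge: "rk M (insert j F) \<ge> rk M F + 1" using rk_insert_outside_flat[OF F _ j, of F] by simp
  \<comment> \<open>Were the rank larger, a basis of \<open>insert j F\<close> could be augmented by
    a point of the cover, but each such point alone leaves the rank of \<open>insert j F\<close>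
    unchanged.\<close>
  have "rk M (cover F j) \<le> rk M (insert j F)"
  proof (rule ccontr)
    assume "\<not> ?thesis"
    moreover obtain B where B: "B \<subseteq> insert j F" "indep M B" "card B = rk M (insert j F)"
      by (rule basis_exists)
    moreover obtain D where D: "D \<subseteq> cover F j" "indep M D" "card D = rk M (cover F j)"
      by (rule basis_exists)
    ultimately obtain y where y: "y \<in> D - B" "indep M (insert y B)"
      using indep_augment[of B D] by auto
    have "card (insert y B) \<le> rk M (insert y (insert j F))"
      by (rule card_le_rk) (use y B in auto)
    also have "\<dots> = card B" using y D B by (auto simp: cover_def)
    finally show False using y finite_indep[OF B(2)] by auto
  qed
  then have "rk M (cover F j) = rk M (insert j F)"
    using rk_mono[OF cover_superset] by simp
  then show ?thesis using ge rk_insert_le[of j F] by simp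
qed

lemma cover_flat: "cover F j \<in> flats M"
proof -
  have eq: "rk M (cover F j) = rk M (insert j F)"
    using rk_cover rk_insert_outside_flat[OF F _ j, of F] rk_insert_le[of j F] by simp
  have "rk M (cover F j) < rk M (insert x (cover F j))" if x: "x \<in> ground M - cover F j" for x
  proof -
    have "rk M (insert x (insert j F)) \<noteq> rk M (insert j F)" using x by (auto simp: cover_def)
    moreover have "rk M (insert j F) \<le> rk M (insert x (insert j F))" by (rule rk_mono) auto
    moreover have "rk M (insert x (insert j F)) \<le> rk M (insert x (cover F j))"
      by (rule rk_mono) (use cover_superset in auto)
    ultimately show ?thesis using eq by simp
  qed
  then show ?thesis by (auto simp: flats_def cover_def)
qed

lemma cover_subset:
  assumes "G \<in> flats M" "F \<subseteq> G" "j \<in> G"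
  shows "cover F j \<subseteq> G"
proof
  fix x assume x: "x \<in> cover F j"
  then have "rk M (insert x G) = rk M G"
    using rk_insert_eq_mono[of "insert j F" G x] assms by (auto simp: cover_def)
  then show "x \<in> G" using x rk_insert_outside_flat[OF assms(1), of G x] by (auto simp: cover_def)
qed

lemma cover_unique:
  assumes "G \<in> flats M" "F \<subseteq> G" "j \<in> G" "rk M G \<le> rk M F + 1"
  shows "G = cover F j"
  using cover_subset[OF assms(1-3)] rk_strict_mono[OF cover_flat assms(1)] rk_cover assms(4) by force

end


section \<open>Weisner's identity\<close>

lemma moebius_refl [simp]: "moebius L A A = 1"
  by (simp add: moebius.simps)

lemma sum_moebius_interval:
  assumes "F \<in> flats M" "G \<in> flats M" "F \<subset> G"
  shows "(\<Sum>H\<in>{H \<in> flats M. F \<subseteq> H \<and> H \<subseteq> G}. moebius (flats M) F H) = 0"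
proof -
  have "{H \<in> flats M. F \<subseteq> H \<and> H \<subseteq> G} = insert G {H \<in> flats M. F \<subseteq> H \<and> H \<subset> G}"
    using assms by auto
  moreover have "moebius (flats M) F G = - (\<Sum>H\<in>{H \<in> flats M. F \<subseteq> H \<and> H \<subset> G}. moebius (flats M) F H)"
    using assms finite_flat by (subst moebius.simps) auto
  ultimately show ?thesis using finite_flats by simp
qed

text \<open>The fibres of \<open>H \<mapsto> H \<or> j\<close> partition the interval \<open>[F, G]\<close>, so induction on \<open>G\<close>
  shows that the Moebius function sums to zero over each fibre.\<close>

lemma weisner:
  assumes "F \<in> flats M" "G \<in> flats M" "F \<subseteq> G" "j \<in> G - F"
  shows "moebius (flats M) F G
    = - (\<Sum>H\<in>{H \<in> flats M. F \<subseteq> H \<and> j \<notin> H \<and> cover H j = G}. moebius (flats M) F H)"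
  using assms
proof (induction "card G" arbitrary: G rule: less_induct)
  case less
  let ?\<mu> = "moebius (flats M) F"
  let ?fib = "\<lambda>G. {H \<in> flats M. F \<subseteq> H \<and> j \<notin> H \<and> cover H j = G}"
  let ?J = "{G' \<in> flats M. F \<subseteq> G' \<and> j \<in> G' \<and> G' \<subset> G}"
  have jE: "j \<in> ground M" using less.prems flats_subset by auto
  have fin: "finite (?fib G')" "finite ?J" for G' using finite_flats by auto
  \<comment> \<open>A flat containing j is its own join with j, so the full fibre over
    \<open>G'\<close> is \<open>G'\<close> together with \<open>?fib G'\<close>, which collects the
    flats avoiding j.\<close>
  have split: "{H \<in> flats M. F \<subseteq> H \<and> H \<subseteq> G} = (insert G ?J) \<union> (\<Union>G'\<in>insert G ?J. ?fib G')"
  proof -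
    have 1: "H \<subseteq> G" if "H \<in> ?fib G'" "G' \<in> insert G ?J" for H G'
      using cover_superset[of H j] that jE by auto
    have 2: "cover H j \<in> insert G ?J" if "H \<in> flats M" "F \<subseteq> H" "H \<subseteq> G" "j \<notin> H" for H
      using cover_superset[of H j] cover_flat[of H j] cover_subset[of H j G] that jE less.prems by auto
    show ?thesis
    proof (intro equalityI subsetI)
      fix H assume H: "H \<in> {H \<in> flats M. F \<subseteq> H \<and> H \<subseteq> G}"
      show "H \<in> (insert G ?J) \<union> (\<Union>G'\<in>insert G ?J. ?fib G')"
      proof (cases "j \<in> H")
        case False
        then have "H \<in> ?fib (cover H j)" "cover H j \<in> insert G ?J" using H 2 by auto
        then show ?thesis by blast
      qed (use H in auto)
    next
      fix H assume "H \<in> (insert G ?J) \<union> (\<Union>G'\<in>insert G ?J. ?fib G')"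
      then consider "H \<in> insert G ?J" | G' where "H \<in> ?fib G'" "G' \<in> insert G ?J" by blast
      then show "H \<in> {H \<in> flats M. F \<subseteq> H \<and> H \<subseteq> G}"
      proof cases
        case 2
        then show ?thesis using 1[of H G'] by blast
      qed (use less.prems in auto)
    qed
  qed
  have "0 = (\<Sum>H\<in>(insert G ?J) \<union> (\<Union>G'\<in>insert G ?J. ?fib G'). ?\<mu> H)"
    using sum_moebius_interval[of F G] less.prems split by (auto simp: psubset_eq)
  also have "\<dots> = (\<Sum>H\<in>insert G ?J. ?\<mu> H) + (\<Sum>H\<in>(\<Union>G'\<in>insert G ?J. ?fib G'). ?\<mu> H)"
    by (rule sum.union_disjoint) (use fin less.prems in auto)
  also have "(\<Sum>H\<in>(\<Union>G'\<in>insert G ?J. ?fib G'). ?\<mu> H) = (\<Sum>G'\<in>insert G ?J. \<Sum>H\<in>?fib G'. ?\<mu> H)"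
    by (rule sum.UNION_disjoint) (use fin in auto)
  also have "(\<Sum>H\<in>insert G ?J. ?\<mu> H) + (\<Sum>G'\<in>insert G ?J. \<Sum>H\<in>?fib G'. ?\<mu> H)
      = (\<Sum>G'\<in>insert G ?J. ?\<mu> G' + (\<Sum>H\<in>?fib G'. ?\<mu> H))"
    by (simp add: sum.distrib)
  also have "\<dots> = (?\<mu> G + (\<Sum>H\<in>?fib G. ?\<mu> H)) + (\<Sum>G'\<in>?J. ?\<mu> G' + (\<Sum>H\<in>?fib G'. ?\<mu> H))"
    using fin by (subst sum.insert) auto
  \<comment> \<open>For \<open>G'\<close> below G the induction hypothesis is exactly the vanishing
    of the fibre sum, which leaves the fibre over G.\<close>
  also have "(\<Sum>G'\<in>?J. ?\<mu> G' + (\<Sum>H\<in>?fib G'. ?\<mu> H)) = 0"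
  proof (rule sum.neutral, rule ballI)
    fix G' assume G': "G' \<in> ?J"
    then have "card G' < card G" using less.prems finite_flat by (intro psubset_card_mono) auto
    then show "?\<mu> G' + (\<Sum>H\<in>?fib G'. ?\<mu> H) = 0" using less.hyps[of G'] G' less.prems by auto
  qed
  finally show ?case by simp
qed

end


section \<open>Characteristic polynomials of minors\<close>

context matroid
begin

context
  fixes F F' :: "'a set" assumes sub: "F \<subseteq> F'"
begin

lemma rk_restriction: "A \<subseteq> F' \<Longrightarrow> rk (restriction M F') A = rk M A"
proof -
  assume "A \<subseteq> F'"
  then have "{X. X \<subseteq> A \<and> X \<subseteq> F' \<and> indep M X} = {X. X \<subseteq> A \<and> indep M X}" by auto
  then show ?thesis by (simp add: rk_def restriction_def)
qed

lemma ground_minor: "ground (minor M F' F) = F' - F"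
  by (simp add: minor_def contraction_def restriction_def)

lemma indep_minor:
  "indep (minor M F' F) X \<longleftrightarrow> X \<subseteq> F' - F \<and> rk M (X \<union> F) = card X + rk M F"
proof -
  have "indep (minor M F' F) X \<longleftrightarrow> X \<subseteq> F' - F \<and>
      rk (restriction M F') (X \<union> F) = card X + rk (restriction M F') F"
    by (simp add: minor_def contraction_def) (simp add: restriction_def)
  moreover have "X \<union> F \<subseteq> F'" if "X \<subseteq> F' - F" using that sub by auto
  ultimately show ?thesis using rk_restriction[of "X \<union> F"] rk_restriction[OF sub] by metis
qed

text \<open>Independence in the minor is a rank equation, so a largest independent set has to be
  produced. Extend a basis of F to one of \<open>A \<union> F\<close>: the extension meets F in
  exactly \<open>rk M F\<close> elements, so its part outside F has the required size.\<close>

lemma rk_minor: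
  assumes A: "A \<subseteq> F' - F"
  shows "rk (minor M F' F) A = rk M (A \<union> F) - rk M F"
proof -
  let ?S = "{X. X \<subseteq> A \<and> indep (minor M F' F) X}"
  have le: "card X \<le> rk M (A \<union> F) - rk M F" if "X \<in> ?S" for X
    using that rk_mono[of "X \<union> F" "A \<union> F"] indep_minor[of X] by force
  obtain B where B: "B \<subseteq> F" "indep M B" "card B = rk M F" by (rule basis_exists)
  obtain B' where B': "B \<subseteq> B'" "B' \<subseteq> A \<union> F" "indep M B'" "card B' = rk M (A \<union> F)"
    by (rule basis_extend[of B "A \<union> F"]) (use B in auto)
  define X where "X = B' - F"
  have "card (B' \<inter> F) = card B"
  proof (rule antisym)
    show "card (B' \<inter> F) \<le> card B"
      using card_le_rk[of "B' \<inter> F" F] B' B(3) indep_mono[of B' "B' \<inter> F"] by auto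
    show "card B \<le> card (B' \<inter> F)"
      by (rule card_mono) (use B B' finite_indep in auto)
  qed
  moreover have "card B' = card (B' \<inter> F) + card X"
    unfolding X_def using finite_indep[OF B'(3)] by (simp add: card_Int_Diff)
  ultimately have card: "rk M (A \<union> F) = card X + rk M F" using B B' by simp
  have XA: "X \<subseteq> A" using B' by (auto simp: X_def)
  have "card B' \<le> rk M (X \<union> F)" by (rule card_le_rk) (use B' in \<open>auto simp: X_def\<close>)
  moreover have "rk M (X \<union> F) \<le> rk M (A \<union> F)" by (rule rk_mono) (use XA in auto)
  ultimately have "rk M (X \<union> F) = card X + rk M F" using B' card by simp
  then have X: "X \<in> ?S" using XA A indep_minor[of X] by auto
  have fin: "finite (card ` ?S)"
    by (rule finite_subset[of _ "{..rk M (A \<union> F) - rk M F}"]) (use le in auto)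
  show ?thesis unfolding rk_def[of "minor M F' F"]
  proof (rule Max_eqI[OF fin])
    show "rk M (A \<union> F) - rk M F \<in> card ` ?S" using X card by (intro image_eqI[of _ _ X]) auto
  qed (use le in auto)
qed

end

context
  fixes F F' assumes F: "F \<in> flats M" and F': "F' \<in> flats M" and sub: "F \<subset> F'"
begin

lemma flats_minor: "flats (minor M F' F) = (\<lambda>G. G - F) ` {G \<in> flats M. F \<subseteq> G \<and> G \<subseteq> F'}"
proof -
  have key: "A \<in> flats (minor M F' F) \<longleftrightarrow> A \<union> F \<in> flats M" if A: "A \<subseteq> F' - F" for A
  proof -
    have gr: "F' \<subseteq> ground M" using F' flats_subset by auto
    have AF: "A \<union> F \<subseteq> F'" "A \<union> F \<subseteq> ground M" using A sub gr by auto
    have rkx: "(rk (minor M F' F) A < rk (minor M F' F) (insert x A)) \<longleftrightarrow>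
        rk M (A \<union> F) < rk M (insert x (A \<union> F))" if "x \<in> F' - F - A" for x
    proof -
      have "rk M F \<le> rk M (A \<union> F)" by (rule rk_mono) auto
      then show ?thesis using that A sub rk_minor[of F F' A] rk_minor[of F F' "insert x A"]
        by (auto simp: less_diff_iff)
    qed
    \<comment> \<open>Points outside the flat \<open>F'\<close> raise the rank of each of its
      subsets, so flatness in M need only be tested at points of \<open>F'\<close>.\<close>
    have out: "rk M (A \<union> F) < rk M (insert x (A \<union> F))" if "x \<in> ground M - F'" for x
      using rk_insert_outside_flat[OF F' AF(1)] that by auto
    have "A \<in> flats (minor M F' F) \<longleftrightarrow>
        (\<forall>x\<in>F' - F - A. rk (minor M F' F) A < rk (minor M F' F) (insert x A))"
      using A sub by (simp add: flats_def ground_minor)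
    also have "\<dots> \<longleftrightarrow> (\<forall>x\<in>F' - F - A. rk M (A \<union> F) < rk M (insert x (A \<union> F)))"
      using rkx by auto
    also have "\<dots> \<longleftrightarrow> (\<forall>x\<in>ground M - (A \<union> F). rk M (A \<union> F) < rk M (insert x (A \<union> F)))"
      using out gr by auto
    finally show ?thesis using AF by (simp add: flats_def)
  qed
  show ?thesis
  proof (intro equalityI subsetI)
    fix A assume A: "A \<in> flats (minor M F' F)"
    then have A': "A \<subseteq> F' - F" using sub by (auto simp: flats_def ground_minor)
    then have "A \<union> F \<in> {G \<in> flats M. F \<subseteq> G \<and> G \<subseteq> F'}" "A = A \<union> F - F"
      using A key sub by auto
    then show "A \<in> (\<lambda>G. G - F) ` {G \<in> flats M. F \<subseteq> G \<and> G \<subseteq> F'}" by blast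
  next
    fix A assume "A \<in> (\<lambda>G. G - F) ` {G \<in> flats M. F \<subseteq> G \<and> G \<subseteq> F'}"
    then obtain G where "G \<in> flats M" "F \<subseteq> G" "G \<subseteq> F'" "A = G - F" by auto
    moreover from this have "A \<union> F = G" by auto
    ultimately show "A \<in> flats (minor M F' F)" using key[of A] by auto
  qed
qed

lemma rk_minor_flat: "F \<subseteq> G \<Longrightarrow> G \<subseteq> F' \<Longrightarrow> rk (minor M F' F) (G - F) = rk M G - rk M F"
  using rk_minor[of F F' "G - F"] sub by (simp add: Diff_mono Un_absorb2)

lemma matroid_rank_minor: "matroid_rank (minor M F' F) = rk M F' - rk M F"
  using rk_minor_flat[of F'] sub by (simp add: matroid_rank_def ground_minor)

lemma moebius_minor:
  assumes "G \<in> flats M" "F \<subseteq> G" "G \<subseteq> F'"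
  shows "moebius (flats (minor M F' F)) {} (G - F) = moebius (flats M) F G"
  using assms
proof (induction "card G" arbitrary: G rule: less_induct)
  case less
  let ?N = "flats (minor M F' F)"
  show ?case
  proof (cases "G = F")
    case False
    then have ss: "F \<subset> G" using less.prems by auto
    let ?I = "{H \<in> flats M. F \<subseteq> H \<and> H \<subset> G}"
    have im: "{C \<in> ?N. {} \<subseteq> C \<and> C \<subset> G - F} = (\<lambda>H. H - F) ` ?I"
    proof (intro equalityI subsetI)
      fix C assume C: "C \<in> {C \<in> ?N. {} \<subseteq> C \<and> C \<subset> G - F}"
      then obtain H where "H \<in> flats M" "F \<subseteq> H" "C = H - F" by (auto simp: flats_minor)
      then show "C \<in> (\<lambda>H. H - F) ` ?I" using C less.prems(2) by (intro image_eqI[of _ _ H]) auto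
    next
      fix C assume "C \<in> (\<lambda>H. H - F) ` ?I"
      then obtain H where "H \<in> flats M" "F \<subseteq> H" "H \<subset> G" "C = H - F" by blast
      then show "C \<in> {C \<in> ?N. {} \<subseteq> C \<and> C \<subset> G - F}"
        using less.prems(2,3) unfolding flats_minor by (intro CollectI conjI image_eqI[of _ _ H]) auto
    qed
    have inj: "inj_on (\<lambda>H. H - F) ?I" by (rule inj_onI) auto
    have "moebius ?N {} (G - F) = - (\<Sum>C\<in>{C \<in> ?N. {} \<subseteq> C \<and> C \<subset> G - F}. moebius ?N {} C)"
      using ss finite_flat[OF less.prems(1)] by (subst moebius.simps) auto
    also have "\<dots> = - (\<Sum>H\<in>?I. moebius ?N {} (H - F))"
      unfolding im by (subst sum.reindex[OF inj]) simp
    also have "(\<Sum>H\<in>?I. moebius ?N {} (H - F)) = (\<Sum>H\<in>?I. moebius (flats M) F H)"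
    proof (rule sum.cong[OF refl])
      fix H assume H: "H \<in> ?I"
      then have "card H < card G" using finite_flat[OF less.prems(1)] by (intro psubset_card_mono) auto
      then show "moebius ?N {} (H - F) = moebius (flats M) F H"
        using less.hyps[of H] H less.prems by auto
    qed
    also have "- \<dots> = moebius (flats M) F G"
      using ss finite_flat[OF less.prems(1)] by (subst (2) moebius.simps) auto
    finally show ?thesis .
  qed simp
qed

lemma char_poly_minor:
  "char_poly (minor M F' F) =
    (\<Sum>G\<in>{G \<in> flats M. F \<subseteq> G \<and> G \<subseteq> F'}. monom (moebius (flats M) F G) (rk M F' - rk M G))"
proof -
  have inj: "inj_on (\<lambda>G. G - F) {G \<in> flats M. F \<subseteq> G \<and> G \<subseteq> F'}" by (rule inj_onI) auto
  have "char_poly (minor M F' F) = (\<Sum>G\<in>{G \<in> flats M. F \<subseteq> G \<and> G \<subseteq> F'}.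
      monom (moebius (flats (minor M F' F)) {} (G - F))
        (matroid_rank (minor M F' F) - rk (minor M F' F) (G - F)))"
    unfolding char_poly_def by (subst (1) flats_minor) (simp add: sum.reindex[OF inj])
  also have "\<dots> = (\<Sum>G\<in>{G \<in> flats M. F \<subseteq> G \<and> G \<subseteq> F'}.
      monom (moebius (flats M) F G) (rk M F' - rk M G))"
    using rk_mono by (intro sum.cong) (auto simp: moebius_minor matroid_rank_minor rk_minor_flat)
  finally show ?thesis .
qed

text \<open>Weisner's identity at j trades the Moebius value of each flat containing j for those of
  the flats avoiding j whose join with j it is, one rank lower. A flat H avoiding j then contributes
  its Moebius value times the difference of two consecutive powers of t, so the division by t - 1
  can be carried out term by term.\<close>

lemma reduced_char_poly_minor:
  assumes j: "j \<in> F' - F"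
  shows "reduced_char_poly (minor M F' F) =
    (\<Sum>H\<in>{H \<in> flats M. F \<subseteq> H \<and> H \<subseteq> F' \<and> j \<notin> H}.
      monom (moebius (flats M) F H) (rk M F' - rk M H - 1))"
proof -
  let ?\<mu> = "moebius (flats M) F" and ?r = "rk M F'"
  let ?A = "{G \<in> flats M. F \<subseteq> G \<and> G \<subseteq> F' \<and> j \<in> G}"
  let ?B = "{G \<in> flats M. F \<subseteq> G \<and> G \<subseteq> F' \<and> j \<notin> G}"
  have jE: "j \<in> ground M" using j F' flats_subset by auto
  have fin: "finite ?A" "finite ?B" using finite_flats by auto
  have cov: "cover H j \<in> ?A" "rk M (cover H j) = rk M H + 1" if "H \<in> ?B" for H
    using that j jE cover_superset[of H j] cover_flat[of H j] cover_subset[of H j F'] rk_cover[of H j] F'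
    by auto
  have "(\<Sum>G\<in>?A. monom (?\<mu> G) (?r - rk M G))
      = (\<Sum>G\<in>?A. \<Sum>H\<in>{H \<in> ?B. cover H j = G}. - monom (?\<mu> H) (?r - rk M H - 1))"
  proof (rule sum.cong[OF refl])
    fix G assume G: "G \<in> ?A"
    have fib: "{H \<in> flats M. F \<subseteq> H \<and> j \<notin> H \<and> cover H j = G} = {H \<in> ?B. cover H j = G}"
      using cover_superset jE G by fastforce
    have "monom (?\<mu> G) (?r - rk M G) = - (\<Sum>H\<in>{H \<in> ?B. cover H j = G}. monom (?\<mu> H) (?r - rk M G))"
      using weisner[of F G j] F G j fib by (simp add: monom_sum minus_monom[symmetric])
    also have "\<dots> = (\<Sum>H\<in>{H \<in> ?B. cover H j = G}. - monom (?\<mu> H) (?r - rk M H - 1))"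
      unfolding sum_negf[symmetric] using cov(2) by (intro sum.cong) auto
    finally show "monom (?\<mu> G) (?r - rk M G)
      = (\<Sum>H\<in>{H \<in> ?B. cover H j = G}. - monom (?\<mu> H) (?r - rk M H - 1))" .
  qed
  also have "\<dots> = (\<Sum>H\<in>?B. - monom (?\<mu> H) (?r - rk M H - 1))"
    by (rule sum.group) (use fin cov in auto)
  finally have A: "(\<Sum>G\<in>?A. monom (?\<mu> G) (?r - rk M G)) = (\<Sum>H\<in>?B. - monom (?\<mu> H) (?r - rk M H - 1))" .
  have "{G \<in> flats M. F \<subseteq> G \<and> G \<subseteq> F'} = ?A \<union> ?B" by auto
  then have "char_poly (minor M F' F)
      = (\<Sum>G\<in>?A. monom (?\<mu> G) (?r - rk M G)) + (\<Sum>G\<in>?B. monom (?\<mu> G) (?r - rk M G))"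
    unfolding char_poly_minor using fin by (simp add: sum.union_disjoint disjoint_iff)
  also have "\<dots> = (\<Sum>H\<in>?B. monom (?\<mu> H) (?r - rk M H) - monom (?\<mu> H) (?r - rk M H - 1))"
    unfolding A by (simp add: sum_subtractf sum_negf)
  also have "\<dots> = (\<Sum>H\<in>?B. [:-1, 1:] * monom (?\<mu> H) (?r - rk M H - 1))"
  proof (rule sum.cong[OF refl])
    fix H assume H: "H \<in> ?B"
    then have "rk M H < ?r" using j by (intro rk_strict_mono[OF _ F']) auto
    then obtain n where n: "?r - rk M H = Suc n" by (metis Suc_diff_Suc)
    show "monom (?\<mu> H) (?r - rk M H) - monom (?\<mu> H) (?r - rk M H - 1)
        = [:-1, 1:] * monom (?\<mu> H) (?r - rk M H - 1)"
      unfolding n by (simp add: monom_Suc)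
  qed
  also have "\<dots> = [:-1, 1:] * (\<Sum>H\<in>?B. monom (?\<mu> H) (?r - rk M H - 1))"
    by (simp only: sum_distrib_left)
  finally show ?thesis unfolding reduced_char_poly_def
    by (simp only:) (rule nonzero_mult_div_cancel_left, simp)
qed

lemma unsigned_coeff_minor:
  assumes j: "j \<in> F' - F" and b: "b < rk M F' - rk M F"
  shows "unsigned_coeff (int b) (minor M F' F) = (- 1) ^ b *
    (\<Sum>H\<in>{H \<in> flats M. F \<subseteq> H \<and> H \<subset> F' \<and> j \<notin> H \<and> rk M H = rk M F + b}. moebius (flats M) F H)"
proof -
  let ?B = "{H \<in> flats M. F \<subseteq> H \<and> H \<subseteq> F' \<and> j \<notin> H}"
  let ?n = "rk M F' - rk M F - 1 - b"
  have "unsigned_coeff (int b) (minor M F' F) = (- 1) ^ b * coeff (reduced_char_poly (minor M F' F)) ?n"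
    unfolding unsigned_coeff_def matroid_rank_minor using b by simp
  also have "coeff (reduced_char_poly (minor M F' F)) ?n
      = (\<Sum>H\<in>?B. if rk M F' - rk M H - 1 = ?n then moebius (flats M) F H else 0)"
    unfolding reduced_char_poly_minor[OF j] by (simp add: coeff_sum)
  also have "\<dots> = (\<Sum>H\<in>{H \<in> ?B. rk M F' - rk M H - 1 = ?n}. moebius (flats M) F H)"
    using finite_flats by (intro sum.inter_filter[symmetric]) auto
  also have "{H \<in> ?B. rk M F' - rk M H - 1 = ?n}
      = {H \<in> flats M. F \<subseteq> H \<and> H \<subset> F' \<and> j \<notin> H \<and> rk M H = rk M F + b}"
  proof -
    \<comment> \<open>The exponents are truncated differences. Since j lies in \<open>F'\<close> but
      not in H, the rank of H is strictly smaller, nothing is truncated, and equal exponents mean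
      equal ranks.\<close>
    have "rk M H < rk M F'" "rk M F \<le> rk M H" if "H \<in> flats M" "F \<subseteq> H" "H \<subseteq> F'" "j \<notin> H" for H
      using that j rk_strict_mono[OF _ F', of H] rk_mono by auto
    then have "rk M F' - rk M H - 1 = ?n \<longleftrightarrow> rk M H = rk M F + b" if "H \<in> ?B" for H
      using that b by fastforce
    then show ?thesis using j by auto
  qed
  finally show ?thesis .
qed

end

end


context matroid
begin

text \<open>The fibre condition in terms of rank: the join of H with j is G iff G contains H and has
  rank one more. In this form the sum over H is of the same kind as in
  \<open>unsigned_coeff_minor\<close>, which is what makes the evaluation of \<alpha> and \<beta>
  inductive.\<close>

lemma weisner_rank:
  assumes "F \<in> flats M" "G \<in> flats M" "F \<subseteq> G" "j \<in> G - F"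
  shows "moebius (flats M) F G
    = - (\<Sum>H\<in>{H \<in> flats M. F \<subseteq> H \<and> H \<subset> G \<and> j \<notin> H \<and> rk M H + 1 = rk M G}. moebius (flats M) F H)"
proof -
  have j: "j \<in> ground M" using assms flats_subset by auto
  have eq: "F \<subseteq> H \<and> j \<notin> H \<and> cover H j = G \<longleftrightarrow> F \<subseteq> H \<and> H \<subset> G \<and> j \<notin> H \<and> rk M H + 1 = rk M G"
    if "H \<in> flats M" for H
  proof (cases "j \<in> H")
    case False
    then have "H \<subset> cover H j" "rk M (cover H j) = rk M H + 1"
      using cover_superset[of H j] rk_cover[of H j] that j by auto
    then show ?thesis using cover_unique[of H j G] that j False assms by auto
  qed simp
  have "{H \<in> flats M. F \<subseteq> H \<and> j \<notin> H \<and> cover H j = G}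
      = {H \<in> flats M. F \<subseteq> H \<and> H \<subset> G \<and> j \<notin> H \<and> rk M H + 1 = rk M G}"
    by (rule Collect_cong, rule conj_cong[OF refl], rule eq)
  then show ?thesis using weisner[OF assms] by simp
qed

end


section \<open>Calculus modulo the Chow relations\<close>

text \<open>A subset C closed under the ring operations and an ideal I of C inside a commutative
  ring type: this keeps the arithmetic of the type class instead of computing in a quotient
  structure. As I absorbs only elements of C, membership in C has to be carried along.\<close>

locale chow_relations = matroid M for M :: "'a matroid_data" +
  fixes x :: "'a set \<Rightarrow> 'r::comm_ring_1" and C I :: "'r set"
  assumes C_0: "0 \<in> C" and C_1: "1 \<in> C"
    and C_add: "u \<in> C \<Longrightarrow> v \<in> C \<Longrightarrow> u + v \<in> C"
    and C_mult: "u \<in> C \<Longrightarrow> v \<in> C \<Longrightarrow> u * v \<in> C"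
    and C_uminus: "u \<in> C \<Longrightarrow> - u \<in> C"
    and I_0: "0 \<in> I"
    and I_add: "u \<in> I \<Longrightarrow> v \<in> I \<Longrightarrow> u + v \<in> I"
    and I_mult: "u \<in> C \<Longrightarrow> v \<in> I \<Longrightarrow> u * v \<in> I"
    and x_C: "G \<in> proper_flats M \<Longrightarrow> x G \<in> C"
    and x_incomparable: "F \<in> proper_flats M \<Longrightarrow> G \<in> proper_flats M \<Longrightarrow>
      \<not> F \<subseteq> G \<Longrightarrow> \<not> G \<subseteq> F \<Longrightarrow> x F * x G \<in> I"
    and x_linear: "i \<in> ground M \<Longrightarrow> j \<in> ground M \<Longrightarrow>
      (\<Sum>G\<in>{G \<in> proper_flats M. i \<in> G}. x G) - (\<Sum>G\<in>{G \<in> proper_flats M. j \<in> G}. x G) \<in> I"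
begin

text \<open>The improper flats act as the unit, so that a chain from \<open>{}\<close> to the ground set gives the
  same product as its proper members.\<close>

definition X :: "'a set \<Rightarrow> 'r" where
  "X F = (if F \<in> proper_flats M then x F else 1)"

text \<open>Congruence after multiplication by the variables of \<open>S\<close>, i.e. modulo the ideal quotient.\<close>

definition ceq :: "'a set set \<Rightarrow> 'r \<Rightarrow> 'r \<Rightarrow> bool" where
  "ceq S u v \<longleftrightarrow> u \<in> C \<and> v \<in> C \<and> (\<Prod>F\<in>S. X F) * (u - v) \<in> I"

lemma C_sum: "(\<And>i. i \<in> A \<Longrightarrow> f i \<in> C) \<Longrightarrow> sum f A \<in> C"
  by (induction A rule: infinite_finite_induct) (auto intro: C_0 C_add)

lemma C_prod: "(\<And>i. i \<in> A \<Longrightarrow> f i \<in> C) \<Longrightarrow> prod f A \<in> C"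
  by (induction A rule: infinite_finite_induct) (auto intro: C_1 C_mult)

lemma C_power: "u \<in> C \<Longrightarrow> u ^ n \<in> C"
  by (induction n) (auto intro: C_1 C_mult)

lemma C_of_nat: "of_nat n \<in> C"
  by (induction n) (auto intro: C_0 C_1 C_add)

lemma C_of_int: "of_int n \<in> C"
  by (cases n rule: int_cases2) (auto intro: C_of_nat C_uminus)

lemma X_C: "X F \<in> C"
  by (auto simp: X_def x_C C_1)

lemmas C_intros = C_0 C_1 C_add C_mult C_uminus C_sum C_prod C_power C_of_nat C_of_int x_C X_C

lemma ceq_refl: "u \<in> C \<Longrightarrow> ceq S u u"
  by (simp add: ceq_def I_0)

lemma ceq_sym: "ceq S u v \<Longrightarrow> ceq S v u"
  using I_mult[of "-1" "(\<Prod>F\<in>S. X F) * (u - v)"] by (simp add: ceq_def C_1 C_uminus algebra_simps)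

lemma ceq_add: "ceq S u v \<Longrightarrow> ceq S u' v' \<Longrightarrow> ceq S (u + u') (v + v')"
  using I_add[of "(\<Prod>F\<in>S. X F) * (u - v)" "(\<Prod>F\<in>S. X F) * (u' - v')"]
  by (simp add: ceq_def C_add algebra_simps)

lemma ceq_uminus: "ceq S u v \<Longrightarrow> ceq S (- u) (- v)"
  using I_mult[of "-1" "(\<Prod>F\<in>S. X F) * (u - v)"] by (simp add: ceq_def C_1 C_uminus algebra_simps)

lemma ceq_diff: "ceq S u v \<Longrightarrow> ceq S u' v' \<Longrightarrow> ceq S (u - u') (v - v')"
  using ceq_add[OF _ ceq_uminus, of S u v u' v'] by simp

lemma ceq_trans [trans]: "ceq S u v \<Longrightarrow> ceq S v w \<Longrightarrow> ceq S u w"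
  using I_add[of "(\<Prod>F\<in>S. X F) * (u - v)" "(\<Prod>F\<in>S. X F) * (v - w)"]
  by (simp add: ceq_def algebra_simps)

lemma ceq_mult:
  assumes "ceq S u v" "ceq S u' v'"
  shows "ceq S (u * u') (v * v')"
proof -
  let ?P = "\<Prod>F\<in>S. X F"
  have "u' * (?P * (u - v)) + v * (?P * (u' - v')) \<in> I"
    by (rule I_add; rule I_mult) (use assms in \<open>auto simp: ceq_def\<close>)
  moreover have "u' * (?P * (u - v)) + v * (?P * (u' - v')) = ?P * (u * u' - v * v')"
    by (simp add: algebra_simps)
  ultimately show ?thesis using assms by (simp add: ceq_def C_mult)
qed

lemma ceq_power: "ceq S u v \<Longrightarrow> ceq S (u ^ n) (v ^ n)"
  by (induction n) (auto intro: ceq_mult ceq_refl C_1)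

lemma ceq_sum: "(\<And>i. i \<in> A \<Longrightarrow> ceq S (f i) (g i)) \<Longrightarrow> ceq S (sum f A) (sum g A)"
  by (induction A rule: infinite_finite_induct) (auto intro: ceq_refl ceq_add C_0)

lemma ceq_prod: "(\<And>i. i \<in> A \<Longrightarrow> ceq S (f i) (g i)) \<Longrightarrow> ceq S (prod f A) (prod g A)"
  by (induction A rule: infinite_finite_induct) (auto intro: ceq_refl ceq_mult C_1)

lemma ceq_mult_0: "ceq S u 0 \<Longrightarrow> v \<in> C \<Longrightarrow> ceq S (u * v) 0"
  using ceq_mult[of S u 0 v v] by (simp add: ceq_refl)

lemma ceq_sum_restrict:
  assumes "finite A" "B \<subseteq> A" "\<And>G. G \<in> A - B \<Longrightarrow> ceq S (f G) 0" "\<And>G. G \<in> B \<Longrightarrow> ceq S (f G) (g G)"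
  shows "ceq S (sum f A) (sum g B)"
proof -
  have "ceq S (sum f (A - B) + sum f B) (sum (\<lambda>_. 0) (A - B) + sum g B)"
    using assms by (intro ceq_add ceq_sum) auto
  then show ?thesis using sum.subset_diff[OF assms(2,1), of f] by simp
qed

lemma ceq_mono:
  assumes "ceq S u v" "S \<subseteq> T" "finite T"
  shows "ceq T u v"
proof -
  have "(\<Prod>F\<in>T - S. X F) * ((\<Prod>F\<in>S. X F) * (u - v)) \<in> I"
    by (rule I_mult[OF C_prod[OF X_C]]) (use assms(1) in \<open>simp add: ceq_def\<close>)
  then show ?thesis
    using assms prod.subset_diff[OF assms(2,3), of X] by (simp add: ceq_def mult.assoc)
qed

text \<open>The means of using ideal quotients: behind a factor \<open>x G\<close>, the flat G may
  be added to the chain. A sum over flats is thus treated term by term, each term with its own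
  enlarged chain. If G is already in S, the product over the set S gains no second factor, and plain
  multiplication suffices.\<close>

lemma ceq_x:
  assumes "ceq (insert G S) u v" "G \<in> proper_flats M" "finite S"
  shows "ceq S (x G * u) (x G * v)"
proof (cases "G \<in> S")
  case True
  then show ?thesis using assms by (simp add: insert_absorb ceq_mult ceq_refl x_C)
next
  case False
  then show ?thesis using assms by (simp add: ceq_def X_def C_mult x_C algebra_simps)
qed

lemma ceq_prod_X:
  assumes "ceq S u v"
  shows "ceq {} ((\<Prod>F\<in>S. X F) * u) ((\<Prod>F\<in>S. X F) * v)"
  using assms by (simp add: ceq_def C_intros algebra_simps)

lemma ceq_improper: "ceq {{}, ground M} u v \<longleftrightarrow> ceq {} u v"
  by (cases "{} = ground M") (auto simp: ceq_def X_def proper_flats_def)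

lemma ceq_incomparable:
  assumes "finite S" "F \<in> S" "F \<in> flats M" "G \<in> proper_flats M" "\<not> F \<subseteq> G" "\<not> G \<subseteq> F"
  shows "ceq S (x G) 0"
proof -
  have "F \<in> proper_flats M"
    using assms flats_subset by (auto simp: proper_flats_def)
  then have "ceq {F} (x G) 0"
    using x_incomparable[of F G] assms by (simp add: ceq_def X_def C_intros)
  then show ?thesis by (rule ceq_mono) (use assms in auto)
qed

section \<open>The classes \<alpha> and \<beta> of an interval of flats\<close>

definition between :: "'a set \<Rightarrow> 'a set \<Rightarrow> 'a set set" where
  "between F F' = {G \<in> flats M. F \<subset> G \<and> G \<subset> F'}"

text \<open>Under \<open>G \<mapsto> G - F\<close> this and \<open>\<beta>\<close> correspond to the
  two standard divisor classes of the minor on \<open>F' - F\<close>, written here in the variables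
  of M.\<close>

definition \<alpha> :: "'a set \<Rightarrow> 'a set \<Rightarrow> 'a \<Rightarrow> 'r" where
  "\<alpha> F F' j = (\<Sum>G\<in>{G \<in> between F F'. j \<in> G}. x G)"

definition \<beta> :: "'a set \<Rightarrow> 'a set \<Rightarrow> 'a \<Rightarrow> 'r" where
  "\<beta> F F' j = (\<Sum>G\<in>{G \<in> between F F'. j \<notin> G}. x G)"

lemma finite_between: "finite (between F F')"
  using finite_flats by (simp add: between_def)

lemma between_proper: "G \<in> between F F' \<Longrightarrow> F' \<in> flats M \<Longrightarrow> G \<in> proper_flats M"
  using flats_subset by (auto simp: between_def proper_flats_def)

lemma \<alpha>_C: "F' \<in> flats M \<Longrightarrow> \<alpha> F F' j \<in> C" and \<beta>_C: "F' \<in> flats M \<Longrightarrow> \<beta> F F' j \<in> C"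
  unfolding \<alpha>_def \<beta>_def by (auto intro!: C_sum x_C dest: between_proper)

lemma \<alpha>_plus_\<beta>: "\<alpha> F F' j + \<beta> F F' j = sum x (between F F')"
proof -
  have "between F F' = {G \<in> between F F'. j \<in> G} \<union> {G \<in> between F F'. j \<notin> G}" by auto
  then have "sum x (between F F') = sum x ({G \<in> between F F'. j \<in> G} \<union> {G \<in> between F F'. j \<notin> G})"
    by simp
  also have "\<dots> = \<alpha> F F' j + \<beta> F F' j"
    unfolding \<alpha>_def \<beta>_def by (rule sum.union_disjoint) (use finite_between in auto)
  finally show ?thesis by simp
qed

text \<open>The common step of the comparisons below: variables incomparable with a member of the
  chain drop out of a sum, so only index sets have to be compared.\<close>

lemma ceq_x_sum_restrict:
  assumes "finite S" "finite A" "A \<subseteq> proper_flats M" "B \<subseteq> A"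
    and "\<And>G. G \<in> A - B \<Longrightarrow> \<exists>F\<in>S. F \<in> flats M \<and> \<not> F \<subseteq> G \<and> \<not> G \<subseteq> F"
  shows "ceq S (sum x A) (sum x B)"
proof (rule ceq_sum_restrict[OF assms(2,4)])
  fix G assume G: "G \<in> A - B"
  then obtain F where "F \<in> S" "F \<in> flats M" "\<not> F \<subseteq> G" "\<not> G \<subseteq> F" using assms(5) by blast
  then show "ceq S (x G) 0" using ceq_incomparable[OF assms(1)] G assms(3) by blast
next
  fix G assume "G \<in> B"
  then show "ceq S (x G) (x G)" using assms by (intro ceq_refl x_C) auto
qed

lemma \<alpha>_indep:
  assumes S: "finite S" "F \<in> S" "F' \<in> S" and F: "F \<in> flats M" "F' \<in> flats M" "F \<subset> F'"
    and ij: "i \<in> F' - F" "j \<in> F' - F"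
  shows "ceq S (\<alpha> F F' i) (\<alpha> F F' j)"
proof -
  let ?U = "{G \<in> proper_flats M. F' \<subseteq> G}" and ?L = "\<lambda>i. {G \<in> proper_flats M. i \<in> G}"
  have finp: "finite (proper_flats M)" using finite_flats by (simp add: proper_flats_def)
  have U: "ceq S (sum x (?L i)) (\<alpha> F F' i + sum x ?U)" if i: "i \<in> F' - F" for i
  proof -
    let ?B = "{G \<in> between F F'. i \<in> G} \<union> ?U"
    have "ceq S (sum x (?L i)) (sum x ?B)"
    proof (rule ceq_x_sum_restrict)
      show "?B \<subseteq> ?L i" using i between_proper F by auto
      fix G assume G: "G \<in> ?L i - ?B"
      then have "\<not> F \<subseteq> G \<and> \<not> G \<subseteq> F \<or> \<not> F' \<subseteq> G \<and> \<not> G \<subseteq> F'"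
        using i by (auto simp: between_def proper_flats_def)
      then show "\<exists>F\<in>S. F \<in> flats M \<and> \<not> F \<subseteq> G \<and> \<not> G \<subseteq> F" using S F by blast
    qed (use S finp in auto)
    moreover have "sum x ?B = \<alpha> F F' i + sum x ?U"
      unfolding \<alpha>_def by (rule sum.union_disjoint) (use finite_flats finp in \<open>auto simp: between_def\<close>)
    ultimately show ?thesis by simp
  qed
  have "ceq {} (sum x (?L i)) (sum x (?L j))"
    using x_linear[of i j] ij F flats_subset[of F'] by (auto simp: ceq_def intro!: C_sum x_C)
  then have "ceq S (sum x (?L i)) (sum x (?L j))" by (rule ceq_mono) (use S in auto)
  then have "ceq S (\<alpha> F F' i + sum x ?U) (\<alpha> F F' j + sum x ?U)"
    using U[OF ij(1)] U[OF ij(2)] ceq_sym ceq_trans by meson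
  then have "ceq S (\<alpha> F F' i + sum x ?U - sum x ?U) (\<alpha> F F' j + sum x ?U - sum x ?U)"
    by (rule ceq_diff) (auto intro!: ceq_refl C_sum x_C)
  then show ?thesis by simp
qed

lemma \<beta>_eq: "\<beta> F F' j = sum x (between F F') - \<alpha> F F' j"
  using \<alpha>_plus_\<beta>[of F F' j] by (simp add: algebra_simps)

lemma \<beta>_indep:
  assumes "finite S" "F \<in> S" "F' \<in> S" "F \<in> flats M" "F' \<in> flats M" "F \<subset> F'"
    and "i \<in> F' - F" "j \<in> F' - F"
  shows "ceq S (\<beta> F F' i) (\<beta> F F' j)"
  unfolding \<beta>_eq by (intro ceq_diff \<alpha>_indep[OF assms] ceq_refl C_sum x_C) (use between_proper assms in auto)

text \<open>Move the point outside G: a flat that contains j and is comparable with G must then lie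
  strictly above G.\<close>

lemma \<alpha>_upper:
  assumes S: "finite S" "F \<in> S" "F' \<in> S" "G \<in> S"
    and F: "F \<in> flats M" "F' \<in> flats M" "G \<in> flats M" "F \<subseteq> G" "G \<subset> F'"
    and ij: "i \<in> F' - F" "j \<in> F' - G"
  shows "ceq S (\<alpha> F F' i) (\<alpha> G F' j)"
proof -
  have "ceq S (\<alpha> F F' i) (\<alpha> F F' j)" using assms by (intro \<alpha>_indep) auto
  also have "ceq S (\<alpha> F F' j) (\<alpha> G F' j)" unfolding \<alpha>_def
  proof (rule ceq_x_sum_restrict)
    fix H assume "H \<in> {H \<in> between F F'. j \<in> H} - {H \<in> between G F'. j \<in> H}"
    then have "\<not> G \<subseteq> H \<and> \<not> H \<subseteq> G" using ij F by (auto simp: between_def)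
    then show "\<exists>F\<in>S. F \<in> flats M \<and> \<not> F \<subseteq> H \<and> \<not> H \<subseteq> F" using S F by blast
  next
    show "{H \<in> between F F'. j \<in> H} \<subseteq> proper_flats M" using between_proper F by auto
    show "{H \<in> between G F'. j \<in> H} \<subseteq> {H \<in> between F F'. j \<in> H}" using F by (auto simp: between_def)
  qed (use S finite_between in auto)
  finally show ?thesis .
qed

text \<open>Dually, move the point into G: a flat that avoids j and is comparable with G must then
  lie strictly below G.\<close>

lemma \<beta>_lower:
  assumes S: "finite S" "F \<in> S" "F' \<in> S" "G \<in> S"
    and F: "F \<in> flats M" "F' \<in> flats M" "G \<in> flats M" "F \<subset> G" "G \<subseteq> F'"
    and ij: "i \<in> F' - F" "j \<in> G - F"
  shows "ceq S (\<beta> F F' i) (\<beta> F G j)"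
proof -
  have "ceq S (\<beta> F F' i) (\<beta> F F' j)" using assms by (intro \<beta>_indep) auto
  also have "ceq S (\<beta> F F' j) (\<beta> F G j)" unfolding \<beta>_def
  proof (rule ceq_x_sum_restrict)
    fix H assume "H \<in> {H \<in> between F F'. j \<notin> H} - {H \<in> between F G. j \<notin> H}"
    then have "\<not> G \<subseteq> H \<and> \<not> H \<subseteq> G" using ij F by (auto simp: between_def)
    then show "\<exists>F\<in>S. F \<in> flats M \<and> \<not> F \<subseteq> H \<and> \<not> H \<subseteq> F" using S F by blast
  next
    show "{H \<in> between F F'. j \<notin> H} \<subseteq> proper_flats M" using between_proper F by auto
    show "{H \<in> between F G. j \<notin> H} \<subseteq> {H \<in> between F F'. j \<notin> H}" using F by (auto simp: between_def)
  qed (use S finite_between in auto)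
  finally show ?thesis .
qed

text \<open>Compute \<alpha> of the whole interval at two points. The point i in G sees \<alpha> of
  the lower interval, G itself and every flat strictly between G and \<open>F'\<close>; the point j
  outside G sees only \<alpha> of the upper interval. Equating the two and solving for
  \<open>x G\<close> leaves the flats above G that avoid j, which is \<beta>.\<close>

lemma self_intersection:
  assumes S: "finite S" "F \<in> S" "F' \<in> S" "G \<in> S"
    and F: "F \<in> flats M" "F' \<in> flats M" "G \<in> flats M" "F \<subset> G" "G \<subset> F'"
    and ij: "i \<in> G - F" "j \<in> F' - G"
  shows "ceq S (x G) (- (\<alpha> F G i + \<beta> G F' j))"
proof -
  let ?T = "sum x (between G F')"
  let ?B = "{H \<in> between F G. i \<in> H} \<union> insert G (between G F')"
  have G: "G \<in> proper_flats M" using between_proper[of G F F'] F by (auto simp: between_def)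
  have TC: "?T \<in> C" using between_proper F by (auto intro!: C_sum x_C)
  have "sum x ?B = \<alpha> F G i + sum x (insert G (between G F'))"
    unfolding \<alpha>_def by (rule sum.union_disjoint) (use finite_flats in \<open>auto simp: between_def\<close>)
  also have "sum x (insert G (between G F')) = x G + ?T"
    by (rule sum.insert) (use finite_flats in \<open>auto simp: between_def\<close>)
  finally have B: "sum x ?B = \<alpha> F G i + (x G + ?T)" .
  have "ceq S (\<alpha> F F' i) (sum x ?B)" unfolding \<alpha>_def
  proof (rule ceq_x_sum_restrict)
    show "?B \<subseteq> {H \<in> between F F'. i \<in> H}" using F ij by (auto simp: between_def)
    show "{H \<in> between F F'. i \<in> H} \<subseteq> proper_flats M" using between_proper F by auto
    fix H assume "H \<in> {H \<in> between F F'. i \<in> H} - ?B"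
    then have "\<not> G \<subseteq> H \<and> \<not> H \<subseteq> G" using ij F by (auto simp: between_def)
    then show "\<exists>F\<in>S. F \<in> flats M \<and> \<not> F \<subseteq> H \<and> \<not> H \<subseteq> F" using S F by blast
  qed (use S finite_between in auto)
  then have "ceq S (sum x ?B) (\<alpha> F F' i)" by (rule ceq_sym)
  also have "ceq S \<dots> (\<alpha> G F' j)" using S F ij by (intro \<alpha>_upper) auto
  finally have "ceq S (sum x ?B - \<alpha> F G i - ?T) (\<alpha> G F' j - \<alpha> F G i - ?T)"
    using F TC by (intro ceq_diff ceq_refl \<alpha>_C) auto
  then show ?thesis unfolding B using \<alpha>_plus_\<beta>[of G F' j, symmetric] by (simp add: algebra_simps)
qed

end


section \<open>Vanishing and evaluation of products of powers of \<alpha> and \<beta>\<close>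

context chow_relations
begin

lemma \<alpha>_mult: "\<alpha> F F' j * w = (\<Sum>G\<in>{G \<in> between F F'. j \<in> G}. x G * w)"
  and \<beta>_mult: "\<beta> F F' j * w = (\<Sum>G\<in>{G \<in> between F F'. j \<notin> G}. x G * w)"
  by (simp_all add: \<alpha>_def \<beta>_def sum_distrib_right)

text \<open>Expand one factor into variables \<open>x G\<close>. Behind \<open>x G\<close> the
  remaining \<alpha> live on the interval above G and the remaining \<beta> on the one below. The
  exponents left sum to at least the total rank minus one, so either \<alpha> fills the upper
  interval up to its rank or \<beta> the lower one, and induction applies. With no \<beta> present,
  a factor \<alpha> is expanded and only the upper interval is needed.\<close>

lemma \<alpha>\<beta>_vanish:
  assumes "finite S" "F \<in> S" "F' \<in> S" "F \<in> flats M" "F' \<in> flats M" "F \<subset> F'" "j \<in> F' - F"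
    and "rk M F' - rk M F \<le> a + b"
  shows "ceq S (\<alpha> F F' j ^ a * \<beta> F F' j ^ b) 0"
  using assms
proof (induction "rk M F' - rk M F" arbitrary: S F F' j a b rule: less_induct)
  case less
  note S = less.prems(1-3) and F = less.prems(4-6) and j = less.prems(7) and ab = less.prems(8)
  have rk: "rk M F < rk M F'" using F by (intro rk_strict_mono)
  show ?case
  proof (cases b)
    case b: (Suc b')
    have "ceq S (x G * (\<alpha> F F' j ^ a * \<beta> F F' j ^ b')) 0" if "G \<in> between F F'" for G
    proof -
      let ?T = "insert G S"
      have G: "G \<in> flats M" "F \<subset> G" "G \<subset> F'" using that by (auto simp: between_def)
      have rkG: "rk M F < rk M G" "rk M G < rk M F'" using G F by (auto intro: rk_strict_mono)
      obtain k where k: "k \<in> F' - G" using G by auto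
      obtain i where i: "i \<in> G - F" using G by auto
      have a: "ceq ?T (\<alpha> F F' j) (\<alpha> G F' k)" using S F G j k by (intro \<alpha>_upper) auto
      have b: "ceq ?T (\<beta> F F' j) (\<beta> F G i)" using S F G j i by (intro \<beta>_lower) auto
      have "ceq ?T (\<alpha> F F' j ^ a * \<beta> F F' j ^ b') (\<alpha> G F' k ^ a * \<beta> F G i ^ b')"
        using a b by (intro ceq_mult ceq_power)
      also have "ceq ?T (\<alpha> G F' k ^ a * \<beta> F G i ^ b') 0"
      proof (cases "rk M F' - rk M G \<le> a")
        case True
        then have "ceq ?T (\<alpha> G F' k ^ a * \<beta> G F' k ^ 0) 0"
          using S F G k rkG rk by (intro less.hyps) auto
        then show ?thesis using ceq_mult_0[of ?T "\<alpha> G F' k ^ a"] C_power[OF \<beta>_C[OF G(1)]] by simp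
      next
        case False
        then have "ceq ?T (\<alpha> F G i ^ 0 * \<beta> F G i ^ b') 0"
          using S F G i rkG rk ab \<open>b = Suc b'\<close> by (intro less.hyps) auto
        then show ?thesis
          using ceq_mult_0[of ?T "\<beta> F G i ^ b'"] C_power[OF \<alpha>_C[OF F(2)]] by (simp add: mult.commute)
      qed
      finally have "ceq S (x G * (\<alpha> F F' j ^ a * \<beta> F F' j ^ b')) (x G * 0)"
        using S that between_proper F by (intro ceq_x) auto
      then show ?thesis by simp
    qed
    then have "ceq S (\<Sum>G\<in>{G \<in> between F F'. j \<notin> G}. x G * (\<alpha> F F' j ^ a * \<beta> F F' j ^ b'))
        (\<Sum>G\<in>{G \<in> between F F'. j \<notin> G}. 0)"
      by (intro ceq_sum) auto
    then show ?thesis unfolding \<beta>_mult[symmetric] b by (simp add: mult_ac)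
  next
    case b: 0
    then obtain a' where a: "a = Suc a'" using ab rk by (cases a) auto
    have "ceq S (x G * \<alpha> F F' j ^ a') 0" if "G \<in> between F F'" for G
    proof -
      let ?T = "insert G S"
      have G: "G \<in> flats M" "F \<subset> G" "G \<subset> F'" using that by (auto simp: between_def)
      have rkG: "rk M F < rk M G" "rk M G < rk M F'" using G F by (auto intro: rk_strict_mono)
      obtain k where k: "k \<in> F' - G" using G by auto
      have "ceq ?T (\<alpha> F F' j ^ a') (\<alpha> G F' k ^ a')"
        using S F G j k by (intro ceq_power \<alpha>_upper) auto
      also have "ceq ?T (\<alpha> G F' k ^ a' * \<beta> G F' k ^ 0) 0"
        using S F G k rkG rk ab a b by (intro less.hyps) auto
      then have "ceq ?T (\<alpha> G F' k ^ a') 0" by simp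
      finally have "ceq S (x G * \<alpha> F F' j ^ a') (x G * 0)"
        using S that between_proper F by (intro ceq_x) auto
      then show ?thesis by simp
    qed
    then have "ceq S (\<Sum>G\<in>{G \<in> between F F'. j \<in> G}. x G * \<alpha> F F' j ^ a')
        (\<Sum>G\<in>{G \<in> between F F'. j \<in> G}. 0)"
      by (intro ceq_sum) auto
    then show ?thesis unfolding \<alpha>_mult[symmetric] a b by simp
  qed
qed

text \<open>Expand one \<alpha> over the flats H containing i. The other factors move to the
  interval above H and are too many there unless H has the least possible rank; the only flat of
  that rank containing F and i is the cover.\<close>

lemma \<alpha>_power_cover:
  assumes S: "finite S" "F \<in> S" "F' \<in> S"
    and F: "F \<in> flats M" "F' \<in> flats M" "F \<subset> F'"
    and i: "i \<in> F' - F" and G: "cover F i \<noteq> F'" and j: "j \<in> F' - cover F i" and k: "k \<in> F' - F"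
  shows "ceq S (\<alpha> F F' k ^ (rk M F' - rk M F - 1))
    (x (cover F i) * \<alpha> (cover F i) F' j ^ (rk M F' - rk M (cover F i) - 1))"
proof -
  define G where "G = cover F i"
  have iE: "i \<in> ground M - F" using i F flats_subset by auto
  have G: "G \<in> flats M" "F \<subset> G" "G \<subset> F'" "i \<in> G" "rk M G = rk M F + 1"
    using cover_flat[OF F(1) iE] cover_superset[OF F(1) iE] cover_subset[OF F(1) iE F(2)] rk_cover[OF F(1) iE]
      i F G by (auto simp: G_def)
  define n where "n = rk M F' - rk M G - 1"
  have n: "rk M F' - rk M F - 1 = Suc n"
    using rk_strict_mono[OF G(1) F(2) G(3)] G(5) by (simp add: n_def)
  have "ceq S (\<alpha> F F' k ^ Suc n) (\<alpha> F F' i ^ Suc n)"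
    using S F i k by (intro ceq_power \<alpha>_indep) auto
  also have "\<alpha> F F' i ^ Suc n = (\<Sum>H\<in>{H \<in> between F F'. i \<in> H}. x H * \<alpha> F F' i ^ n)"
    by (simp add: \<alpha>_mult)
  also have "ceq S \<dots> (\<Sum>H\<in>{G}. x H * \<alpha> G F' j ^ n)"
  proof (rule ceq_sum_restrict)
    fix H assume H: "H \<in> {H \<in> between F F'. i \<in> H} - {G}"
    let ?T = "insert H S"
    have H': "H \<in> flats M" "F \<subset> H" "H \<subset> F'" "i \<in> H" using H by (auto simp: between_def)
    obtain l where l: "l \<in> F' - H" using H' by auto
    have "\<not> rk M H \<le> rk M F + 1" using cover_unique[OF F(1) iE, of H] H H' by (auto simp: G_def)
    then have rkH: "rk M F' - rk M H \<le> n + 0" using G(5) by (simp add: n_def)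
    have "ceq ?T (\<alpha> F F' i ^ n) (\<alpha> H F' l ^ n)"
      using S F H' i l by (intro ceq_power \<alpha>_upper) auto
    also have "ceq ?T (\<alpha> H F' l ^ n * \<beta> H F' l ^ 0) 0"
      by (rule \<alpha>\<beta>_vanish) (use S F H' l rkH in auto)
    then have "ceq ?T (\<alpha> H F' l ^ n) 0" by simp
    finally have "ceq S (x H * \<alpha> F F' i ^ n) (x H * 0)"
      using S H between_proper F by (intro ceq_x) auto
    then show "ceq S (x H * \<alpha> F F' i ^ n) 0" by simp
  next
    fix H assume H: "H \<in> {G}"
    have "ceq (insert G S) (\<alpha> F F' i ^ n) (\<alpha> G F' j ^ n)"
      using S F G i j by (intro ceq_power \<alpha>_upper) (auto simp: G_def)
    then show "ceq S (x H * \<alpha> F F' i ^ n) (x H * \<alpha> G F' j ^ n)"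
      using H S G between_proper[of G F F'] F by (auto intro!: ceq_x simp: between_def)
  qed (use finite_flats G(1-4) in \<open>simp_all add: between_def\<close>)
  finally show ?thesis unfolding n by (simp add: n_def G_def)
qed

text \<open>Climb from F to G by covers, each taken out of the lower power of \<alpha>. When the
  cover reaches G that power is exhausted, and \<open>\<alpha>_power_cover\<close> read backwards
  absorbs the variables into the power on the whole interval.\<close>

lemma \<alpha>_power_split:
  assumes "finite S" "F \<in> S" "F' \<in> S"
    and "F \<in> flats M" "G \<in> flats M" "F' \<in> flats M" "F \<subset> G" "G \<subset> F'"
    and "i \<in> G - F" "j \<in> F' - G" "k \<in> F' - F"
  shows "ceq S (x G * (\<alpha> F G i ^ (rk M G - rk M F - 1) * \<alpha> G F' j ^ (rk M F' - rk M G - 1)))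
    (\<alpha> F F' k ^ (rk M F' - rk M F - 1))"
  using assms
proof (induction "rk M G - rk M F" arbitrary: S F i k rule: less_induct)
  case less
  note S = less.prems(1-3) and F = less.prems(4-8) and ijk = less.prems(9-11)
  define H where "H = cover F i"
  have iE: "i \<in> ground M - F" using ijk F flats_subset by auto
  have H: "H \<in> flats M" "F \<subset> H" "H \<subseteq> G" "i \<in> H" "rk M H = rk M F + 1"
    using cover_flat[OF F(1) iE] cover_superset[OF F(1) iE] cover_subset[OF F(1) iE F(2)] rk_cover[OF F(1) iE]
      iE ijk(1) F(4) by (auto simp: H_def)
  have HF': "cover F i \<noteq> F'" using H(3) F(5) by (auto simp: H_def)
  have Gp: "G \<in> proper_flats M" using between_proper[of G F F'] F by (auto simp: between_def)
  show ?case
  proof (cases "H = G")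
    case True
    then show ?thesis
      using ceq_sym[OF \<alpha>_power_cover[OF S F(1,3) psubset_trans[OF F(4,5)] _ HF', where j = j and k = k]]
        ijk H(5) F(5) by (simp add: H_def psubsetD)
  next
    case False
    then have HG: "H \<subset> G" using H by auto
    obtain l where l: "l \<in> G - H" using HG by auto
    let ?A = "\<alpha> G F' j ^ (rk M F' - rk M G - 1)"
    have Hp: "H \<in> proper_flats M" using between_proper[of H F F'] H HG F by (auto simp: between_def)
    have AC: "?A \<in> C" using F by (intro C_power \<alpha>_C)
    have "ceq (insert G S) (\<alpha> F G i ^ (rk M G - rk M F - 1)) (x H * \<alpha> H G l ^ (rk M G - rk M H - 1))"
      unfolding H_def by (rule \<alpha>_power_cover) (use S F ijk l HG in \<open>auto simp: H_def\<close>)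
    then have "ceq S (x G * (\<alpha> F G i ^ (rk M G - rk M F - 1) * ?A))
        (x G * (x H * \<alpha> H G l ^ (rk M G - rk M H - 1) * ?A))"
      using S Gp AC by (intro ceq_x ceq_mult ceq_refl)
    also have "\<dots> = x H * (x G * (\<alpha> H G l ^ (rk M G - rk M H - 1) * ?A))" by (simp add: mult_ac)
    also have "ceq S \<dots> (x H * \<alpha> H F' j ^ (rk M F' - rk M H - 1))"
    proof (rule ceq_x[OF _ Hp S(1)], rule less.hyps)
      show "rk M G - rk M H < rk M G - rk M F"
        using H(5) rk_strict_mono[OF H(1) F(2) HG] by auto
    qed (use S F H HG l ijk in auto)
    also have "ceq S \<dots> (\<alpha> F F' k ^ (rk M F' - rk M F - 1))"
      unfolding H_def by (rule ceq_sym[OF \<alpha>_power_cover]) (use S F ijk HF' HG in \<open>auto simp: H_def\<close>)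
    finally show ?thesis .
  qed
qed

text \<open>Iterates \<open>\<alpha>_power_cover\<close> from the bottom. Members of the flag are
  indexed by their rank, so prepending the cover of F needs no shift of indices.\<close>

lemma \<alpha>_power_flag:
  assumes "finite S" "F \<in> S" "F' \<in> S" "F \<in> flats M" "F' \<in> flats M" "F \<subset> F'" "j \<in> F' - F"
  obtains G where "\<And>m. m \<in> {rk M F + 1..<rk M F'} \<Longrightarrow> G m \<in> between F F'"
    and "\<And>m. m \<in> {rk M F + 1..<rk M F'} \<Longrightarrow> m + 1 < rk M F' \<Longrightarrow> G m \<subset> G (m + 1)"
    and "ceq S (\<alpha> F F' j ^ (rk M F' - rk M F - 1)) (\<Prod>m\<in>{rk M F + 1..<rk M F'}. x (G m))"
proof -
  have "\<exists>G. (\<forall>m\<in>{rk M F + 1..<rk M F'}. G m \<in> between F F') \<and>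
     (\<forall>m\<in>{rk M F + 1..<rk M F'}. m + 1 < rk M F' \<longrightarrow> G m \<subset> G (m + 1)) \<and>
     ceq S (\<alpha> F F' j ^ (rk M F' - rk M F - 1)) (\<Prod>m\<in>{rk M F + 1..<rk M F'}. x (G m))"
    using assms
  proof (induction "rk M F' - rk M F" arbitrary: S F j rule: less_induct)
    case less
    note S = less.prems(1-3) and F = less.prems(4-6) and j = less.prems(7)
    define H where "H = cover F j"
    have jE: "j \<in> ground M - F" using j F flats_subset by auto
    have H: "H \<in> flats M" "F \<subset> H" "H \<subseteq> F'" "rk M H = rk M F + 1"
      using cover_flat[OF F(1) jE] cover_superset[OF F(1) jE] cover_subset[OF F(1) jE F(2)] rk_cover[OF F(1) jE]
        j F by (auto simp: H_def)
    show ?case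
    proof (cases "H = F'")
      case True
      then show ?thesis using H(4) by (auto intro: ceq_refl C_1)
    next
      case False
      then have HF': "H \<subset> F'" using H by auto
      then obtain k where k: "k \<in> F' - H" by auto
      have rkH: "rk M H < rk M F'" using rk_strict_mono[OF H(1) F(2) HF'] .
      have Hb: "H \<in> between F F'" using H HF' by (auto simp: between_def)
      have Hp: "H \<in> proper_flats M" using between_proper[OF Hb F(2)] .
      have "\<exists>G. (\<forall>m\<in>{rk M H + 1..<rk M F'}. G m \<in> between H F') \<and>
         (\<forall>m\<in>{rk M H + 1..<rk M F'}. m + 1 < rk M F' \<longrightarrow> G m \<subset> G (m + 1)) \<and>
         ceq (insert H S) (\<alpha> H F' k ^ (rk M F' - rk M H - 1)) (\<Prod>m\<in>{rk M H + 1..<rk M F'}. x (G m))"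
        by (rule less.hyps) (use S F H HF' k rkH in auto)
      then obtain G where G: "\<And>m. m \<in> {rk M H + 1..<rk M F'} \<Longrightarrow> G m \<in> between H F'"
        "\<And>m. m \<in> {rk M H + 1..<rk M F'} \<Longrightarrow> m + 1 < rk M F' \<Longrightarrow> G m \<subset> G (m + 1)"
        "ceq (insert H S) (\<alpha> H F' k ^ (rk M F' - rk M H - 1)) (\<Prod>m\<in>{rk M H + 1..<rk M F'}. x (G m))"
        by blast
      define G' where "G' = G(rk M H := H)"
      have split: "{rk M F + 1..<rk M F'} = insert (rk M H) {rk M H + 1..<rk M F'}"
        using H(4) rkH by auto
      have "ceq S (\<alpha> F F' j ^ (rk M F' - rk M F - 1)) (x H * \<alpha> H F' k ^ (rk M F' - rk M H - 1))"
        unfolding H_def by (rule \<alpha>_power_cover) (use S F j k False in \<open>auto simp: H_def\<close>)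
      also have "ceq S \<dots> (x H * (\<Prod>m\<in>{rk M H + 1..<rk M F'}. x (G m)))"
        by (rule ceq_x[OF G(3) Hp S(1)])
      also have "(\<Prod>m\<in>{rk M H + 1..<rk M F'}. x (G m)) = (\<Prod>m\<in>{rk M H + 1..<rk M F'}. x (G' m))"
        by (rule prod.cong) (auto simp: G'_def)
      also have "x H * \<dots> = (\<Prod>m\<in>{rk M F + 1..<rk M F'}. x (G' m))"
        unfolding split by (subst prod.insert) (auto simp: G'_def)
      finally have 1: "ceq S (\<alpha> F F' j ^ (rk M F' - rk M F - 1)) (\<Prod>m\<in>{rk M F + 1..<rk M F'}. x (G' m))" .
      have 2: "G' m \<in> between F F'" if "m \<in> {rk M F + 1..<rk M F'}" for m
      proof (cases "m = rk M H")
        case False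
        then have "G m \<in> between H F'" using that G(1)[of m] H(4) by auto
        then show ?thesis using False H(2) unfolding G'_def between_def by fastforce
      qed (use Hb in \<open>simp add: G'_def\<close>)
      have 3: "G' m \<subset> G' (m + 1)" if "m \<in> {rk M F + 1..<rk M F'}" "m + 1 < rk M F'" for m
        using that G(2)[of m] G(1)[of "m + 1"] unfolding split by (auto simp: G'_def between_def)
      show ?thesis using 1 2 3 by blast
    qed
  qed
  then show thesis using that by blast
qed

text \<open>Expand one \<beta> over the flats G avoiding j; by rank only those of rank
  \<open>rk M F + b\<close> survive. There the remaining \<beta> exactly fill the lower interval and
  the \<alpha> the upper one, so induction evaluates the former and
  \<open>\<alpha>_power_split\<close> glues the two powers of \<alpha>. The explicit Moebius sum,
  rather than the coefficient of the minor, is what the induction can feed to Weisner's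
  identity.\<close>

lemma \<alpha>\<beta>_eval_sum:
  assumes "finite S" "F \<in> S" "F' \<in> S" "F \<in> flats M" "F' \<in> flats M" "F \<subset> F'" "j \<in> F' - F"
    and "a + b + 1 = rk M F' - rk M F"
  shows "ceq S (\<alpha> F F' j ^ a * \<beta> F F' j ^ b)
    (of_int ((- 1) ^ b * (\<Sum>H\<in>{H \<in> flats M. F \<subseteq> H \<and> H \<subset> F' \<and> j \<notin> H \<and> rk M H = rk M F + b}.
        moebius (flats M) F H)) * \<alpha> F F' j ^ (rk M F' - rk M F - 1))"
  using assms
proof (induction "rk M F' - rk M F" arbitrary: S F F' j a b rule: less_induct)
  case less
  note S = less.prems(1-3) and F = less.prems(4-6) and j = less.prems(7) and ab = less.prems(8)
  let ?\<mu> = "moebius (flats M)"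
  have rk: "rk M F < rk M F'" using F by (intro rk_strict_mono)
  show ?case
  proof (cases b)
    case b: 0
    have "H = F" if "H \<in> flats M" "F \<subseteq> H" "rk M H = rk M F" for H
      using that rk_strict_mono[OF F(1) that(1)] by auto
    then have "{H \<in> flats M. F \<subseteq> H \<and> H \<subset> F' \<and> j \<notin> H \<and> rk M H = rk M F + b} = {F}"
      using F j b by auto
    moreover have "rk M F' - rk M F - 1 = a" using ab b by simp
    ultimately show ?thesis using b F by (simp only:) (simp add: ceq_refl C_intros \<alpha>_C)
  next
    case b: (Suc b')
    let ?n = "rk M F' - rk M F - 1"
    let ?A = "{G \<in> between F F'. j \<notin> G}" and ?B = "{H \<in> flats M. F \<subseteq> H \<and> H \<subset> F' \<and> j \<notin> H \<and> rk M H = rk M F + b}"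
    have lhs: "\<alpha> F F' j ^ a * \<beta> F F' j ^ b = (\<Sum>G\<in>?A. x G * (\<alpha> F F' j ^ a * \<beta> F F' j ^ b'))"
      unfolding \<beta>_mult[symmetric] b by (simp add: mult_ac)
    have "ceq S (\<Sum>G\<in>?A. x G * (\<alpha> F F' j ^ a * \<beta> F F' j ^ b'))
        (\<Sum>G\<in>?B. of_int ((- 1) ^ b * ?\<mu> F G) * \<alpha> F F' j ^ ?n)"
    proof (rule ceq_sum_restrict)
      show "?B \<subseteq> ?A" using b by (auto simp: between_def)
    next
      fix G assume GA: "G \<in> ?A - ?B"
      let ?T = "insert G S"
      have G: "G \<in> flats M" "F \<subset> G" "G \<subset> F'" using GA by (auto simp: between_def)
      have rkG: "rk M F < rk M G" "rk M G < rk M F'" "rk M G \<noteq> rk M F + b"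
        using G F GA by (auto intro: rk_strict_mono simp: between_def)
      obtain k where k: "k \<in> F' - G" using G by auto
      obtain i where i: "i \<in> G - F" using G by auto
      have "ceq ?T (\<alpha> F F' j ^ a * \<beta> F F' j ^ b') (\<alpha> G F' k ^ a * \<beta> F G i ^ b')"
        by (intro ceq_mult ceq_power \<alpha>_upper \<beta>_lower) (use S F G j k i in auto)
      also have "ceq ?T (\<alpha> G F' k ^ a * \<beta> F G i ^ b') 0"
      \<comment> \<open>If G has rank above \<open>rk M F + b\<close>, the upper interval is too
        short for the \<alpha>; if below, the lower interval is too short for the \<beta>.\<close>
      proof (cases "rk M F' - rk M G \<le> a")
        case True
        then have "ceq ?T (\<alpha> G F' k ^ a * \<beta> G F' k ^ 0) 0"
          using S F G k by (intro \<alpha>\<beta>_vanish) auto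
        then show ?thesis using ceq_mult_0[of ?T "\<alpha> G F' k ^ a"] C_power[OF \<beta>_C[OF G(1)]] by simp
      next
        case False
        then have "ceq ?T (\<alpha> F G i ^ 0 * \<beta> F G i ^ b') 0"
          using S F G i rkG rk ab b by (intro \<alpha>\<beta>_vanish) auto
        then show ?thesis
          using ceq_mult_0[of ?T "\<beta> F G i ^ b'"] C_power[OF \<alpha>_C[OF F(2)]] by (simp add: mult.commute)
      qed
      finally have "ceq S (x G * (\<alpha> F F' j ^ a * \<beta> F F' j ^ b')) (x G * 0)"
        using S GA between_proper F by (intro ceq_x) auto
      then show "ceq S (x G * (\<alpha> F F' j ^ a * \<beta> F F' j ^ b')) 0" by simp
    next
      fix G assume GB: "G \<in> ?B"
      let ?T = "insert G S"
      have G: "G \<in> flats M" "F \<subset> G" "G \<subset> F'" and rkG: "rk M G = rk M F + b" using GB b by auto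
      have rkG': "rk M G < rk M F'" using G F by (auto intro: rk_strict_mono)
      obtain k where k: "k \<in> F' - G" using G by auto
      obtain i where i: "i \<in> G - F" using G by auto
      have Gp: "G \<in> proper_flats M" using between_proper[of G F F'] G F by (auto simp: between_def)
      \<comment> \<open>Weisner's identity folds the Moebius sum over the flats one rank below G
        into a single value at G, and its minus sign raises the exponent of the sign from
        \<open>b'\<close> to b.\<close>
      have "(- 1) ^ b' * (\<Sum>H\<in>{H \<in> flats M. F \<subseteq> H \<and> H \<subset> G \<and> i \<notin> H \<and> rk M H = rk M F + b'}. ?\<mu> F H)
          = (- 1) ^ b * ?\<mu> F G"
        using weisner_rank[OF F(1) G(1) _ i] G rkG b by (simp add: psubset_imp_subset)
      then have "ceq ?T (\<alpha> F G i ^ 0 * \<beta> F G i ^ b')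
          (of_int ((- 1) ^ b * ?\<mu> F G) * \<alpha> F G i ^ (rk M G - rk M F - 1))"
        using less.hyps[of G F ?T i 0 b'] S F G i b rkG rkG' by auto
      then have "ceq ?T (\<beta> F G i ^ b') (of_int ((- 1) ^ b * ?\<mu> F G) * \<alpha> F G i ^ (rk M G - rk M F - 1))"
        by simp
      moreover have "ceq ?T (\<alpha> F F' j ^ a * \<beta> F F' j ^ b') (\<alpha> G F' k ^ a * \<beta> F G i ^ b')"
        by (intro ceq_mult ceq_power \<alpha>_upper \<beta>_lower) (use S F G j k i in auto)
      ultimately have "ceq ?T (\<alpha> F F' j ^ a * \<beta> F F' j ^ b')
          (\<alpha> G F' k ^ a * (of_int ((- 1) ^ b * ?\<mu> F G) * \<alpha> F G i ^ (rk M G - rk M F - 1)))"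
        by (rule ceq_trans[OF _ ceq_mult[OF ceq_refl], rotated 2]) (use F in \<open>auto intro: C_power \<alpha>_C\<close>)
      then have "ceq S (x G * (\<alpha> F F' j ^ a * \<beta> F F' j ^ b'))
          (x G * (\<alpha> G F' k ^ a * (of_int ((- 1) ^ b * ?\<mu> F G) * \<alpha> F G i ^ (rk M G - rk M F - 1))))"
        using S Gp by (intro ceq_x)
      also have "\<dots> = of_int ((- 1) ^ b * ?\<mu> F G) *
          (x G * (\<alpha> F G i ^ (rk M G - rk M F - 1) * \<alpha> G F' k ^ (rk M F' - rk M G - 1)))"
      proof -
        have "a = rk M F' - rk M G - 1" using ab rkG by simp
        then show ?thesis by (simp only: mult_ac)
      qed
      also have "ceq S \<dots> (of_int ((- 1) ^ b * ?\<mu> F G) * \<alpha> F F' j ^ ?n)"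
        by (intro ceq_mult ceq_refl C_of_int \<alpha>_power_split) (use S F G i j k in auto)
      finally show "ceq S (x G * (\<alpha> F F' j ^ a * \<beta> F F' j ^ b'))
          (of_int ((- 1) ^ b * ?\<mu> F G) * \<alpha> F F' j ^ ?n)" .
    qed (use finite_between in auto)
    moreover have "(\<Sum>G\<in>?B. of_int ((- 1) ^ b * ?\<mu> F G) * \<alpha> F F' j ^ ?n)
        = of_int ((- 1) ^ b * (\<Sum>G\<in>?B. ?\<mu> F G)) * \<alpha> F F' j ^ ?n"
      unfolding sum_distrib_left of_int_sum sum_distrib_right by (rule refl)
    ultimately show ?thesis unfolding lhs by (simp only:)
  qed
qed

lemma \<alpha>\<beta>_eval:
  assumes "finite S" "F \<in> S" "F' \<in> S" "F \<in> flats M" "F' \<in> flats M" "F \<subset> F'" "j \<in> F' - F"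
    and "a + b + 1 = rk M F' - rk M F"
  shows "ceq S (\<alpha> F F' j ^ a * \<beta> F F' j ^ b)
    (of_int (unsigned_coeff (int b) (minor M F' F)) * \<alpha> F F' j ^ (rk M F' - rk M F - 1))"
  using \<alpha>\<beta>_eval_sum[OF assms] unsigned_coeff_minor[OF assms(4-7), of b] assms(8) by simp

end


context matroid
begin

text \<open>Needed for the bottom interval of the chain: it receives no \<beta>, and its coefficient
  must be 1 for the product in the formula to start at index 1.\<close>

lemma unsigned_coeff_minor_0:
  assumes "F \<in> flats M" "F' \<in> flats M" "F \<subset> F'"
  shows "unsigned_coeff 0 (minor M F' F) = 1"
proof -
  obtain j where j: "j \<in> F' - F" using assms by auto
  have "H = F" if "H \<in> flats M" "F \<subseteq> H" "rk M H = rk M F" for H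
    using that rk_strict_mono[OF assms(1) that(1)] by auto
  then have "{H \<in> flats M. F \<subseteq> H \<and> H \<subset> F' \<and> j \<notin> H \<and> rk M H = rk M F} = {F}"
    using assms j by auto
  then show ?thesis
    using unsigned_coeff_minor[OF assms j, of 0] rk_strict_mono[OF assms] by simp
qed

end


section \<open>Monomials supported on a chain of flats\<close>

context chow_relations
begin

context
  fixes F :: "nat \<Rightarrow> 'a set" and e :: "nat \<Rightarrow> nat" and d k :: nat
  assumes rank: "rk M (ground M) = d + 1"
    and F_0: "F 0 = {}" and F_top: "F (k + 1) = ground M"
    and F_flat: "\<And>i. i \<le> k + 1 \<Longrightarrow> F i \<in> flats M"
    and F_chain: "\<And>i. i \<le> k \<Longrightarrow> F i \<subset> F (i + 1)"
    and e_pos: "\<And>i. i \<in> {1..k} \<Longrightarrow> e i > 0"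
    and e_sum: "(\<Sum>i = 1..k. e i) = d"
begin

text \<open>The classes depend on the point up to congruence only; fixing one point per interval
  turns them into ring elements that can be multiplied and expanded.\<close>

definition seg_pt :: "nat \<Rightarrow> 'a" where "seg_pt i = (SOME j. j \<in> F (i + 1) - F i)"
definition seg_\<alpha> :: "nat \<Rightarrow> 'r" where "seg_\<alpha> i = \<alpha> (F i) (F (i + 1)) (seg_pt i)"
definition seg_\<beta> :: "nat \<Rightarrow> 'r" where "seg_\<beta> i = \<beta> (F i) (F (i + 1)) (seg_pt i)"
definition seg_rk :: "nat \<Rightarrow> nat" where "seg_rk i = rk M (F (i + 1)) - rk M (F i)"
definition partial_deg :: "nat \<Rightarrow> nat" where "partial_deg i = (\<Sum>j = 1..i. e j)"

abbreviation Fs :: "'a set set" where "Fs \<equiv> F ` {..k + 1}"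

lemma seg_pt_in: "i \<le> k \<Longrightarrow> seg_pt i \<in> F (i + 1) - F i"
  unfolding seg_pt_def by (rule someI_ex) (use F_chain in auto)

lemma rk_F_less: "i < j \<Longrightarrow> j \<le> k + 1 \<Longrightarrow> rk M (F i) < rk M (F j)"
proof (induction j)
  case (Suc j)
  have "rk M (F j) < rk M (F (Suc j))"
    using F_flat[of j] F_flat[of "Suc j"] F_chain[of j] Suc.prems by (intro rk_strict_mono) auto
  then show ?case using Suc by (cases "i = j") auto
qed simp

lemma F_mono: "i \<le> j \<Longrightarrow> j \<le> k + 1 \<Longrightarrow> F i \<subseteq> F j"
proof (induction j)
  case (Suc j)
  then show ?case using F_chain[of j] by (cases "i = Suc j") auto
qed simp

lemma seg_\<alpha>_C: "i \<le> k \<Longrightarrow> seg_\<alpha> i \<in> C" and seg_\<beta>_C: "i \<le> k \<Longrightarrow> seg_\<beta> i \<in> C"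
  unfolding seg_\<alpha>_def seg_\<beta>_def using F_flat by (auto intro: \<alpha>_C \<beta>_C)

lemma F_proper: "i \<in> {1..k} \<Longrightarrow> F i \<in> proper_flats M"
  using F_flat[of i] rk_F_less[of 0 i] rk_F_less[of i "k + 1"] F_0 F_top
  by (auto simp: proper_flats_def)

lemma prod_X_Fs: "(\<Prod>G\<in>Fs. X G) = (\<Prod>i = 1..k. x (F i))"
proof -
  have inj: "inj_on F {..k + 1}"
    by (rule linorder_inj_onI) (use rk_F_less in \<open>fastforce+\<close>)
  have "(\<Prod>G\<in>Fs. X G) = (\<Prod>i\<in>{..k + 1}. X (F i))"
    by (subst prod.reindex[OF inj]) simp
  also have "\<dots> = (\<Prod>i = 1..k. x (F i))"
  proof (rule prod.mono_neutral_cong_right)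
    show "\<forall>i\<in>{..k + 1} - {1..k}. X (F i) = 1"
    proof
      fix i assume "i \<in> {..k + 1} - {1..k}"
      then have "i = 0 \<or> i = k + 1" by auto
      then show "X (F i) = 1" using F_0 F_top by (auto simp: X_def proper_flats_def)
    qed
  qed (use F_proper in \<open>auto simp: X_def\<close>)
  finally show ?thesis .
qed

lemma sum_seg_rk: "m \<le> k \<Longrightarrow> (\<Sum>i\<le>m. seg_rk i) = rk M (F (m + 1))"
proof (induction m)
  case 0
  then show ?case using F_0 by (simp add: seg_rk_def)
next
  case (Suc m)
  then show ?case using rk_F_less[of "m + 1" "m + 2"] by (simp add: seg_rk_def)
qed

text \<open>The congruence is relative to the two ends alone, because the inner flats occur as
  explicit factors; each is used up when \<open>\<alpha>_power_split\<close> glues the next interval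
  on.\<close>

lemma chain_\<alpha>:
  assumes "m \<le> k"
  shows "ceq {F 0, F (m + 1)} ((\<Prod>i = 1..m. x (F i)) * (\<Prod>i\<le>m. seg_\<alpha> i ^ (seg_rk i - 1)))
    (\<alpha> (F 0) (F (m + 1)) (seg_pt 0) ^ (rk M (F (m + 1)) - 1))"
  using assms
proof (induction m)
  case 0
  have "\<alpha> (F 0) (F 1) (seg_pt 0) \<in> C" using F_flat[of 1] by (intro \<alpha>_C) auto
  then show ?case using F_0 by (simp add: seg_\<alpha>_def seg_rk_def ceq_refl C_power)
next
  case (Suc m)
  let ?Q = "(\<Prod>i = 1..m. x (F i)) * (\<Prod>i\<le>m. seg_\<alpha> i ^ (seg_rk i - 1))"
  let ?a = "seg_\<alpha> (m + 1) ^ (seg_rk (m + 1) - 1)"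
  let ?S = "{F 0, F (m + 2)}"
  have flat: "F 0 \<in> flats M" "F (m + 1) \<in> flats M" "F (m + 2) \<in> flats M"
    using F_flat[of 0] F_flat[of "m + 1"] F_flat[of "m + 2"] Suc.prems by auto
  have sub: "F 0 \<subset> F (m + 1)" "F (m + 1) \<subset> F (m + 2)"
    using F_chain[of "m + 1"] F_0 rk_F_less[of 0 "m + 1"] Suc.prems by auto
  have "(\<Prod>i = 1..Suc m. x (F i)) * (\<Prod>i\<le>Suc m. seg_\<alpha> i ^ (seg_rk i - 1)) = x (F (m + 1)) * (?Q * ?a)"
    by (simp add: mult_ac)
  also have "ceq ?S \<dots> (x (F (m + 1)) * (\<alpha> (F 0) (F (m + 1)) (seg_pt 0) ^ (rk M (F (m + 1)) - 1) * ?a))"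
  proof (rule ceq_x)
    have "ceq (insert (F (m + 1)) ?S) ?Q (\<alpha> (F 0) (F (m + 1)) (seg_pt 0) ^ (rk M (F (m + 1)) - 1))"
      by (rule ceq_mono[OF Suc.IH]) (use Suc.prems in auto)
    then show "ceq (insert (F (m + 1)) ?S) (?Q * ?a)
        (\<alpha> (F 0) (F (m + 1)) (seg_pt 0) ^ (rk M (F (m + 1)) - 1) * ?a)"
      using seg_\<alpha>_C Suc.prems by (intro ceq_mult ceq_refl C_power) auto
  qed (use F_proper Suc.prems in auto)
  also have "ceq ?S \<dots> (\<alpha> (F 0) (F (m + 2)) (seg_pt 0) ^ (rk M (F (m + 2)) - 1))"
  proof -
    \<comment> \<open>The point of the bottom interval lies in every later member of the chain, so
      it serves for all initial intervals.\<close>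
    have p0: "seg_pt 0 \<in> F (m + 1) - F 0" using seg_pt_in[of 0] F_mono[of 1 "m + 1"] Suc.prems F_0 by auto
    have p1: "seg_pt (m + 1) \<in> F (m + 2) - F (m + 1)" using seg_pt_in[of "m + 1"] Suc.prems by simp
    have "ceq ?S (x (F (m + 1)) * (\<alpha> (F 0) (F (m + 1)) (seg_pt 0) ^ (rk M (F (m + 1)) - rk M (F 0) - 1) *
        \<alpha> (F (m + 1)) (F (m + 2)) (seg_pt (m + 1)) ^ (rk M (F (m + 2)) - rk M (F (m + 1)) - 1)))
      (\<alpha> (F 0) (F (m + 2)) (seg_pt 0) ^ (rk M (F (m + 2)) - rk M (F 0) - 1))"
      by (rule \<alpha>_power_split) (use flat sub p0 p1 in auto)
    then show ?thesis using F_0 by (simp add: seg_\<alpha>_def seg_rk_def)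
  qed
  finally show ?case by simp
qed

lemma top_\<alpha>:
  "ceq {} ((\<Prod>i = 1..k. x (F i)) * (\<Prod>i\<le>k. seg_\<alpha> i ^ (seg_rk i - 1))) (\<alpha> {} (ground M) (seg_pt 0) ^ d)"
  using chain_\<alpha>[of k] F_0 F_top rank ceq_improper by simp

text \<open>The coefficient of the summand in which \<open>g i\<close> of the copies at
  \<open>F i\<close> contribute \<beta>. The condition says that \<open>g i\<close> solves the
  degree balance, written additively to avoid truncated subtraction.\<close>

definition coeff_term :: "(nat \<Rightarrow> nat) \<Rightarrow> int" where
  "coeff_term g = (if \<forall>i\<in>{1..k}. rk M (F i) + g i = partial_deg i
     then \<Prod>i = 1..k. int (e i - 1 choose g i) * unsigned_coeff (int (g i)) (minor M (F (i + 1)) (F i))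
     else 0)"

text \<open>Comparing degrees interval by interval: a summand survives only if every interval
  \<open>[F i, F (i + 1)]\<close> carries exactly \<open>seg_rk i - 1\<close> factors.\<close>

lemma expanded_term:
  assumes g: "\<And>i. i \<in> {1..k} \<Longrightarrow> g i \<le> e i - 1"
  shows "ceq Fs (\<Prod>i = 1..k. of_nat (e i - 1 choose g i) * seg_\<beta> i ^ g i * seg_\<alpha> (i - 1) ^ (e i - 1 - g i))
    (of_int (coeff_term g) * (\<Prod>i\<le>k. seg_\<alpha> i ^ (seg_rk i - 1)))"
proof -
  \<comment> \<open>Regroup the factors by interval: \<alpha> comes from the flat at its top,
    \<beta> from the flat at its bottom. The last interval gets no \<alpha> and the first no
    \<beta>, since the ground set and the empty set carry no variable.\<close>
  define u where "u i = (if i = k then 0 else e (i + 1) - 1 - g (i + 1))" for i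
  define v where "v i = (if i = 0 then 0 else g i)" for i
  let ?c = "\<Prod>i = 1..k. e i - 1 choose g i"
  have rk_le: "rk M (F i) < rk M (F (i + 1))" if "i \<le> k" for i using rk_F_less that by simp
  have lhs: "(\<Prod>i = 1..k. of_nat (e i - 1 choose g i) * seg_\<beta> i ^ g i * seg_\<alpha> (i - 1) ^ (e i - 1 - g i))
      = of_nat ?c * (\<Prod>i\<le>k. seg_\<alpha> i ^ u i * seg_\<beta> i ^ v i)"
  proof -
    have "(\<Prod>i\<le>k. seg_\<beta> i ^ v i) = (\<Prod>i = 1..k. seg_\<beta> i ^ g i)"
      by (simp add: prod.atMost_shift prod.atLeast1_atMost_eq v_def)
    moreover have "(\<Prod>i\<le>k. seg_\<alpha> i ^ u i) = (\<Prod>i<k. seg_\<alpha> i ^ u i)"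
      by (simp add: lessThan_Suc_atMost[symmetric] u_def)
    moreover have "(\<Prod>i<k. seg_\<alpha> i ^ u i) = (\<Prod>i = 1..k. seg_\<alpha> (i - 1) ^ (e i - 1 - g i))"
      by (simp add: prod.atLeast1_atMost_eq u_def)
    ultimately show ?thesis by (simp add: prod.distrib mult_ac)
  qed
  have seg: "finite Fs" "F i \<in> Fs" "F (i + 1) \<in> Fs" "F i \<in> flats M" "F (i + 1) \<in> flats M"
    "F i \<subset> F (i + 1)" "seg_pt i \<in> F (i + 1) - F i" if "i \<le> k" for i
    using that F_flat[of i] F_flat[of "i + 1"] F_chain[of i] seg_pt_in[of i] by auto
  have partial_deg_Suc: "partial_deg (i + 1) = partial_deg i + e (i + 1)" for i by (simp add: partial_deg_def)
  have partial_deg_k: "partial_deg k = d" using e_sum by (simp add: partial_deg_def)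
  \<comment> \<open>The balance of a single interval is the difference of the conditions at its two
    ends; conversely the balances telescope, starting from rank and degree zero at the empty
    flat.\<close>
  have exact_iff: "(\<forall>i\<in>{1..k}. rk M (F i) + g i = partial_deg i) \<longleftrightarrow> (\<forall>i\<le>k. u i + v i + 1 = seg_rk i)"
  proof
    assume *: "\<forall>i\<in>{1..k}. rk M (F i) + g i = partial_deg i"
    then have **: "rk M (F i) + v i = partial_deg i" if "i \<le> k" for i
      using that F_0 by (auto simp: v_def partial_deg_def)
    show "\<forall>i\<le>k. u i + v i + 1 = seg_rk i"
    proof (intro allI impI)
      fix i assume i: "i \<le> k"
      show "u i + v i + 1 = seg_rk i"
      proof (cases "i = k")
        case True
        then show ?thesis using **[of i] partial_deg_k F_top rank by (simp add: u_def seg_rk_def)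
      next
        case False
        then show ?thesis
          using **[of i] *[rule_format, of "i + 1"] partial_deg_Suc[of i] g[of "i + 1"] e_pos[of "i + 1"] i
            rk_le[of i] by (auto simp: u_def seg_rk_def)
      qed
    qed
  next
    assume *: "\<forall>i\<le>k. u i + v i + 1 = seg_rk i"
    have **: "rk M (F i) + v i = partial_deg i" if "i \<le> k" for i
      using that
    proof (induction i)
      case 0
      then show ?case using F_0 by (simp add: v_def partial_deg_def)
    next
      case (Suc i)
      then show ?case
        using *[rule_format, of i] partial_deg_Suc[of i] g[of "i + 1"] e_pos[of "i + 1"] rk_le[of i]
        by (auto simp: u_def seg_rk_def v_def)
    qed
    show "\<forall>i\<in>{1..k}. rk M (F i) + g i = partial_deg i"
    proof
      fix i assume "i \<in> {1..k}"
      then show "rk M (F i) + g i = partial_deg i" using **[of i] by (simp add: v_def)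
    qed
  qed
  have uv: "seg_\<alpha> i ^ u i \<in> C" "seg_\<beta> i ^ v i \<in> C" if "i \<le> k" for i
    using that seg_\<alpha>_C seg_\<beta>_C by (auto intro: C_power)
  show ?thesis
  proof (cases "\<forall>i\<le>k. u i + v i + 1 = seg_rk i")
    case True
    let ?w = "\<lambda>i. unsigned_coeff (int (v i)) (minor M (F (i + 1)) (F i))"
    have "ceq Fs (of_nat ?c * (\<Prod>i\<le>k. seg_\<alpha> i ^ u i * seg_\<beta> i ^ v i))
        (of_nat ?c * (\<Prod>i\<le>k. of_int (?w i) * seg_\<alpha> i ^ (seg_rk i - 1)))"
    proof (rule ceq_mult[OF ceq_refl[OF C_of_nat] ceq_prod])
      fix i assume "i \<in> {..k}"
      then have i: "i \<le> k" by simp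
      show "ceq Fs (seg_\<alpha> i ^ u i * seg_\<beta> i ^ v i) (of_int (?w i) * seg_\<alpha> i ^ (seg_rk i - 1))"
        unfolding seg_\<alpha>_def seg_\<beta>_def seg_rk_def
        by (rule \<alpha>\<beta>_eval) (use seg[OF i] True i in \<open>auto simp: seg_rk_def\<close>)
    qed
    moreover have "(\<Prod>i\<le>k. ?w i) = (\<Prod>i = 1..k. unsigned_coeff (int (g i)) (minor M (F (i + 1)) (F i)))"
      using unsigned_coeff_minor_0[OF seg(4,5,6)[of 0]]
      by (simp add: prod.atMost_shift prod.atLeast1_atMost_eq v_def)
    then have "of_int (coeff_term g) = (of_nat ?c * of_int (\<Prod>i\<le>k. ?w i) :: 'r)"
      using True exact_iff by (simp add: coeff_term_def prod.distrib)
    ultimately show ?thesis unfolding lhs by (simp add: prod.distrib mult.assoc)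
  next
    case False
    \<comment> \<open>The exponents sum to \<open>d - k\<close>, and so do the values
      \<open>seg_rk i - 1\<close> over the \<open>k + 1\<close> intervals. An interval that is not
      filled exactly therefore forces some interval to be overfull.\<close>
    have "\<exists>i\<le>k. seg_rk i \<le> u i + v i"
    proof (rule ccontr)
      assume "\<not> ?thesis"
      then have le: "\<And>i. i \<in> {..k} \<Longrightarrow> u i + v i + 1 \<le> seg_rk i" by force
      have "(\<Sum>i\<le>k. u i + v i + 1) = (\<Sum>i\<le>k. u i) + (\<Sum>i\<le>k. v i) + (k + 1)"
        unfolding sum.distrib by simp
      also have "(\<Sum>i\<le>k. u i) = (\<Sum>i<k. u i)" by (simp add: lessThan_Suc_atMost[symmetric] u_def)
      also have "\<dots> = (\<Sum>i = 1..k. e i - 1 - g i)" by (simp add: sum.atLeast1_atMost_eq u_def)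
      also have "(\<Sum>i\<le>k. v i) = (\<Sum>i = 1..k. g i)"
        by (simp add: sum.atMost_shift sum.atLeast1_atMost_eq v_def)
      also have "(\<Sum>i = 1..k. e i - 1 - g i) + (\<Sum>i = 1..k. g i) + (k + 1)
          = (\<Sum>i = 1..k. (e i - 1 - g i) + g i + 1) + 1"
        unfolding sum.distrib by simp
      also have "(\<Sum>i = 1..k. (e i - 1 - g i) + g i + 1) = (\<Sum>i = 1..k. e i)"
        by (rule sum.cong) (use g e_pos in \<open>force+\<close>)
      also have "\<dots> + 1 = (\<Sum>i\<le>k. seg_rk i)" using sum_seg_rk[of k] e_sum F_top rank by simp
      finally have "(\<Sum>i\<le>k. u i + v i + 1) = (\<Sum>i\<le>k. seg_rk i)" .
      then show False using sum_mono_inv[of "\<lambda>i. u i + v i + 1" "{..k}" seg_rk] le False by auto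
    qed
    then obtain i where i: "i \<le> k" "seg_rk i \<le> u i + v i" by blast
    have "ceq Fs (seg_\<alpha> i ^ u i * seg_\<beta> i ^ v i) 0"
      unfolding seg_\<alpha>_def seg_\<beta>_def by (rule \<alpha>\<beta>_vanish) (use seg[OF i(1)] i in \<open>auto simp: seg_rk_def\<close>)
    then have "ceq Fs (seg_\<alpha> i ^ u i * seg_\<beta> i ^ v i * (of_nat ?c * (\<Prod>j\<in>{..k} - {i}. seg_\<alpha> j ^ u j * seg_\<beta> j ^ v j))) 0"
      by (rule ceq_mult_0) (use uv in \<open>auto intro!: C_mult C_of_nat C_prod\<close>)
    moreover have "(\<Prod>i\<le>k. seg_\<alpha> i ^ u i * seg_\<beta> i ^ v i)
        = seg_\<alpha> i ^ u i * seg_\<beta> i ^ v i * (\<Prod>j\<in>{..k} - {i}. seg_\<alpha> j ^ u j * seg_\<beta> j ^ v j)"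
      using i by (intro prod.remove) auto
    moreover have "coeff_term g = 0" using False exact_iff by (auto simp: coeff_term_def)
    ultimately show ?thesis unfolding lhs by (simp add: mult_ac)
  qed
qed

text \<open>The degree balance determines g on \<open>{1..k}\<close>, so at most one summand is
  nonzero. If the solution is negative or exceeds \<open>e i - 1\<close> for some i, no g qualifies,
  and on the other side the convention for \<open>binom\<close> makes a factor zero.\<close>

lemma sum_coeff_term:
  "(\<Sum>g\<in>PiE {1..k} (\<lambda>i. {..e i - 1}). coeff_term g) =
    (\<Prod>i = 1..k. binom (int (e i) - 1) (int (partial_deg i) - int (rk M (F i))) *
      unsigned_coeff (int (partial_deg i) - int (rk M (F i))) (minor M (F (i + 1)) (F i)))"
  (is "sum _ ?P = ?K")
proof -
  let ?h = "\<lambda>i. partial_deg i - rk M (F i)"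
  have fin: "finite ?P" by (intro finite_PiE) auto
  show ?thesis
  proof (cases "\<forall>i\<in>{1..k}. rk M (F i) \<le> partial_deg i \<and> ?h i \<le> e i - 1")
    case True
    let ?g = "restrict ?h {1..k}"
    have g: "?g \<in> ?P" using True by auto
    have eq: "g = ?g" if "g \<in> ?P" "\<forall>i\<in>{1..k}. rk M (F i) + g i = partial_deg i" for g
      by (rule PiE_ext[OF that(1) g]) (use that(2) in force)
    have "coeff_term g = (if g = ?g then ?K else 0)" if gP: "g \<in> ?P" for g
    proof (cases "g = ?g")
      case g_eq: True
      have "coeff_term ?g = (\<Prod>i = 1..k. int (e i - 1 choose ?h i) *
          unsigned_coeff (int (?h i)) (minor M (F (i + 1)) (F i)))"
        using True by (simp add: coeff_term_def)
      also have "\<dots> = ?K"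
      proof (rule prod.cong[OF refl])
        fix i assume i: "i \<in> {1..k}"
        then have h: "int (partial_deg i) - int (rk M (F i)) = int (?h i)" "int (e i) - 1 = int (e i - 1)" "?h i \<le> e i - 1"
          using True[rule_format, OF i] e_pos[OF i] by linarith+
        have "binom (int (e i) - 1) (int (partial_deg i) - int (rk M (F i))) = int (e i - 1 choose ?h i)"
          unfolding h(1,2) binom_def using h(3) by (simp only: nat_int of_nat_le_iff of_nat_0_le_iff simp_thms if_True)
        then show "int (e i - 1 choose ?h i) * unsigned_coeff (int (?h i)) (minor M (F (i + 1)) (F i))
          = binom (int (e i) - 1) (int (partial_deg i) - int (rk M (F i))) *
            unsigned_coeff (int (partial_deg i) - int (rk M (F i))) (minor M (F (i + 1)) (F i))"
          unfolding h(1) by (rule arg_cong2[where f = "(*)", OF sym refl])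
      qed
      finally show ?thesis using g_eq by simp
    next
      case False
      then show ?thesis using eq[OF gP] by (auto simp: coeff_term_def)
    qed
    then have "sum coeff_term ?P = (\<Sum>g\<in>?P. if g = ?g then ?K else 0)" by (intro sum.cong) auto
    then show ?thesis using g fin by (simp add: sum.delta)
  next
    case False
    then obtain i where i: "i \<in> {1..k}" "\<not> (rk M (F i) \<le> partial_deg i \<and> ?h i \<le> e i - 1)" by blast
    have "coeff_term g = 0" if "g \<in> ?P" for g
    proof -
      have "g i \<le> e i - 1" using that i by auto
      then have "rk M (F i) + g i \<noteq> partial_deg i" using i by auto
      then show ?thesis using i by (auto simp: coeff_term_def)
    qed
    then have "sum coeff_term ?P = 0" by simp
    moreover have "binom (int (e i) - 1) (int (partial_deg i) - int (rk M (F i))) = 0"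
      using i by (auto simp: binom_def)
    then have "?K = 0" using i(1) by (intro prod_zero) auto
    ultimately show ?thesis by simp
  qed
qed

text \<open>One copy of each variable is kept: their product is precisely the multiplier behind
  \<open>ceq Fs\<close> and thus pays for every congruence relative to the chain. Only the remaining
  \<open>d - k\<close> copies are substituted.\<close>

lemma chain_monomial_ceq:
  "ceq {} (\<Prod>i = 1..k. x (F i) ^ e i)
    (of_int ((- 1) ^ (d - k) *
       (\<Prod>i = 1..k. binom (int (e i) - 1) (int (\<Sum>j = 1..i. e j) - int (rk M (F i))) *
         unsigned_coeff (int (\<Sum>j = 1..i. e j) - int (rk M (F i))) (minor M (F (i + 1)) (F i))))
     * \<alpha> {} (ground M) (seg_pt 0) ^ d)"
proof -
  let ?N = "\<lambda>i. e i - 1" and ?P = "PiE {1..k} (\<lambda>i. {..e i - 1})"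
  let ?t = "\<lambda>i g. of_nat (?N i choose g) * seg_\<beta> i ^ g * seg_\<alpha> (i - 1) ^ (?N i - g)"
  let ?AA = "\<Prod>i\<le>k. seg_\<alpha> i ^ (seg_rk i - 1)" and ?x = "\<Prod>i = 1..k. x (F i)"
  have sumN: "(\<Sum>i = 1..k. ?N i) = d - k"
  proof -
    have "(\<Sum>i = 1..k. ?N i) + k = (\<Sum>i = 1..k. ?N i + 1)" by (subst sum.distrib) simp
    also have "\<dots> = (\<Sum>i = 1..k. e i)" by (rule sum.cong) (use e_pos in force)+
    finally show ?thesis using e_sum by simp
  qed
  have "ceq Fs (\<Prod>i = 1..k. x (F i) ^ ?N i) (\<Prod>i = 1..k. (- (seg_\<alpha> (i - 1) + seg_\<beta> i)) ^ ?N i)"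
  proof (intro ceq_prod ceq_power)
    fix i assume i: "i \<in> {1..k}"
    then obtain i' where i': "i = i' + 1" "i' + 1 \<le> k" by (cases i) auto
    show "ceq Fs (x (F i)) (- (seg_\<alpha> (i - 1) + seg_\<beta> i))"
      unfolding seg_\<alpha>_def seg_\<beta>_def i'(1) add_diff_cancel_right'
      by (rule self_intersection)
        (use i'(2) F_flat F_chain seg_pt_in[of i'] seg_pt_in[of "i' + 1"] F_chain[of i'] F_chain[of "i' + 1"] in auto)
  qed
  also have "(\<Prod>i = 1..k. (- (seg_\<alpha> (i - 1) + seg_\<beta> i)) ^ ?N i) = (-1) ^ (d - k) * (\<Sum>g\<in>?P. \<Prod>i = 1..k. ?t i (g i))"
  proof -
    \<comment> \<open>The summation index counts the copies that contribute \<beta>; the sign is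
      split off here so that it collects to \<open>(-1) ^ (d - k)\<close>.\<close>
    have "(- (seg_\<alpha> (i - 1) + seg_\<beta> i)) ^ ?N i = (-1) ^ ?N i * (\<Sum>g\<le>?N i. ?t i g)" for i
      using binomial_ring[of "seg_\<beta> i" "seg_\<alpha> (i - 1)" "?N i"] power_minus[of "seg_\<alpha> (i - 1) + seg_\<beta> i" "?N i"]
      by (simp add: add.commute)
    then have "(\<Prod>i = 1..k. (- (seg_\<alpha> (i - 1) + seg_\<beta> i)) ^ ?N i)
        = (\<Prod>i = 1..k. (-1) ^ ?N i) * (\<Prod>i = 1..k. \<Sum>g\<le>?N i. ?t i g)"
      by (simp add: prod.distrib)
    also have "(\<Prod>i = 1..k. (-1) ^ ?N i) = (-1 :: 'r) ^ (d - k)"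
      unfolding sumN[symmetric] by (simp add: power_sum)
    also have "(\<Prod>i = 1..k. \<Sum>g\<le>?N i. ?t i g) = (\<Sum>g\<in>?P. \<Prod>i = 1..k. ?t i (g i))"
      by (rule prod_sum_PiE) auto
    finally show ?thesis .
  qed
  finally have 1: "ceq Fs (\<Prod>i = 1..k. x (F i) ^ ?N i) ((-1) ^ (d - k) * (\<Sum>g\<in>?P. \<Prod>i = 1..k. ?t i (g i)))" .
  have "ceq Fs (\<Sum>g\<in>?P. \<Prod>i = 1..k. ?t i (g i)) (\<Sum>g\<in>?P. of_int (coeff_term g) * ?AA)"
    by (intro ceq_sum expanded_term) auto
  then have 2: "ceq Fs ((-1) ^ (d - k) * (\<Sum>g\<in>?P. \<Prod>i = 1..k. ?t i (g i)))
      ((-1) ^ (d - k) * (\<Sum>g\<in>?P. of_int (coeff_term g) * ?AA))"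
    by (intro ceq_mult ceq_refl C_power C_uminus C_1)
  have 3: "ceq {} (?x * (\<Prod>i = 1..k. x (F i) ^ ?N i))
      (?x * ((-1) ^ (d - k) * (\<Sum>g\<in>?P. of_int (coeff_term g) * ?AA)))"
    using ceq_prod_X[OF ceq_trans[OF 1 2]] by (simp only: prod_X_Fs)
  have 4: "?x * ((-1) ^ (d - k) * (\<Sum>g\<in>?P. of_int (coeff_term g) * ?AA))
      = of_int ((-1) ^ (d - k) * sum coeff_term ?P) * (?x * ?AA)"
    by (simp add: sum_distrib_right[symmetric] mult_ac)
  have 5: "ceq {} (of_int ((-1) ^ (d - k) * sum coeff_term ?P) * (?x * ?AA))
      (of_int ((-1) ^ (d - k) * sum coeff_term ?P) * \<alpha> {} (ground M) (seg_pt 0) ^ d)"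
    by (rule ceq_mult[OF ceq_refl[OF C_of_int] top_\<alpha>])
  have 6: "?x * (\<Prod>i = 1..k. x (F i) ^ ?N i) = (\<Prod>i = 1..k. x (F i) ^ e i)"
    unfolding prod.distrib[symmetric]
  proof (rule prod.cong[OF refl])
    fix i assume "i \<in> {1..k}"
    then show "x (F i) * x (F i) ^ ?N i = x (F i) ^ e i" using e_pos[of i] by (simp add: power_eq_if)
  qed
  show ?thesis using ceq_trans[OF 3[unfolded 4 6] 5] unfolding sum_coeff_term partial_deg_def .
qed

text \<open>The power of \<alpha> is traded for a full flag because products over full flags are the
  monomials whose degree is prescribed.\<close>

theorem chain_monomial_flag:
  obtains G where "\<And>m. m \<in> {1..d} \<Longrightarrow> G m \<in> proper_flats M"
    and "\<And>m. m \<in> {1..<d} \<Longrightarrow> G m \<subset> G (m + 1)"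
    and "ceq {} (\<Prod>i = 1..k. x (F i) ^ e i)
      (of_int ((- 1) ^ (d - k) *
         (\<Prod>i = 1..k. binom (int (e i) - 1) (int (\<Sum>j = 1..i. e j) - int (rk M (F i))) *
           unsigned_coeff (int (\<Sum>j = 1..i. e j) - int (rk M (F i))) (minor M (F (i + 1)) (F i))))
       * (\<Prod>m = 1..d. x (G m)))"
proof -
  have "{} \<in> flats M" using F_flat[of 0] F_0 by simp
  moreover have "seg_pt 0 \<in> ground M - {}" using seg_pt_in[of 0] F_mono[of 1 "k + 1"] F_top by auto
  ultimately obtain G where G: "\<And>m. m \<in> {rk M {} + 1..<rk M (ground M)} \<Longrightarrow> G m \<in> between {} (ground M)"
    "\<And>m. m \<in> {rk M {} + 1..<rk M (ground M)} \<Longrightarrow> m + 1 < rk M (ground M) \<Longrightarrow> G m \<subset> G (m + 1)"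
    "ceq {{}, ground M} (\<alpha> {} (ground M) (seg_pt 0) ^ (rk M (ground M) - rk M {} - 1))
      (\<Prod>m\<in>{rk M {} + 1..<rk M (ground M)}. x (G m))"
    using \<alpha>_power_flag[of "{{}, ground M}" "{}" "ground M" "seg_pt 0"] ground_flat by auto
  have int: "{rk M {} + 1..<rk M (ground M)} = {1..d}" using rank by auto
  have "ceq {} (\<alpha> {} (ground M) (seg_pt 0) ^ d) (\<Prod>m = 1..d. x (G m))"
    using G(3) unfolding int ceq_improper using rank by simp
  then show thesis
    using G(1,2) rank unfolding int
    by (intro that[of G] ceq_trans[OF chain_monomial_ceq] ceq_mult ceq_refl C_of_int)
      (auto intro: between_proper ground_flat)
qed

end

end


section \<open>The Chow ring\<close>

lemma poly_ring_simps [simp]: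
  "mult (poly_ring M) = (*)" "one (poly_ring M) = 1" "zero (poly_ring M) = 0" "add (poly_ring M) = (+)"
  by (simp_all add: poly_ring_def)

lemma carrier_poly_ring:
  "p \<in> carrier (poly_ring M) \<longleftrightarrow> (\<forall>m\<in>Poly_Mapping.keys p. Poly_Mapping.keys m \<subseteq> proper_flats M)"
  by (simp add: poly_ring_def)

lemma carrier_poly_ring_add:
  "p \<in> carrier (poly_ring M) \<Longrightarrow> q \<in> carrier (poly_ring M) \<Longrightarrow> p + q \<in> carrier (poly_ring M)"
  using keys_add[of p q] by (auto simp: carrier_poly_ring)

lemma carrier_poly_ring_uminus: "p \<in> carrier (poly_ring M) \<Longrightarrow> - p \<in> carrier (poly_ring M)"
  by (simp add: carrier_poly_ring)

lemma carrier_poly_ring_diff: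
  "p \<in> carrier (poly_ring M) \<Longrightarrow> q \<in> carrier (poly_ring M) \<Longrightarrow> p - q \<in> carrier (poly_ring M)"
  using carrier_poly_ring_add[of p M "- q"] carrier_poly_ring_uminus by auto

lemma carrier_poly_ring_mult:
  assumes "p \<in> carrier (poly_ring M)" "q \<in> carrier (poly_ring M)"
  shows "p * q \<in> carrier (poly_ring M)"
  unfolding carrier_poly_ring
proof
  fix m assume "m \<in> Poly_Mapping.keys (p * q)"
  then obtain a b where "m = a + b" "a \<in> Poly_Mapping.keys p" "b \<in> Poly_Mapping.keys q"
    using keys_mult[of p q] by blast
  then show "Poly_Mapping.keys m \<subseteq> proper_flats M"
    using assms keys_add[of a b] by (fastforce simp: carrier_poly_ring)
qed

lemma carrier_poly_ring_0: "0 \<in> carrier (poly_ring M)"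
  and carrier_poly_ring_1: "1 \<in> carrier (poly_ring M)"
  and carrier_poly_ring_const: "const c \<in> carrier (poly_ring M)"
  by (simp_all add: carrier_poly_ring const_def)

lemma carrier_poly_ring_var: "G \<in> proper_flats M \<Longrightarrow> var G \<in> carrier (poly_ring M)"
  by (simp add: carrier_poly_ring var_def)

lemma carrier_poly_ring_sum: "(\<And>i. i \<in> A \<Longrightarrow> f i \<in> carrier (poly_ring M)) \<Longrightarrow> sum f A \<in> carrier (poly_ring M)"
  by (induction A rule: infinite_finite_induct) (auto intro: carrier_poly_ring_0 carrier_poly_ring_add)

lemma carrier_poly_ring_prod: "(\<And>i. i \<in> A \<Longrightarrow> f i \<in> carrier (poly_ring M)) \<Longrightarrow> prod f A \<in> carrier (poly_ring M)"
  by (induction A rule: infinite_finite_induct) (auto intro: carrier_poly_ring_1 carrier_poly_ring_mult)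

lemma cring_poly_ring: "cring (poly_ring M)"
proof (rule cringI)
  show "abelian_group (poly_ring M)"
  proof (rule abelian_groupI)
    fix p assume p: "p \<in> carrier (poly_ring M)"
    show "\<exists>q\<in>carrier (poly_ring M). q \<oplus>\<^bsub>poly_ring M\<^esub> p = \<zero>\<^bsub>poly_ring M\<^esub>"
      by (rule bexI[OF _ carrier_poly_ring_uminus[OF p]]) simp
  qed (simp_all add: carrier_poly_ring_0 carrier_poly_ring_add algebra_simps)
  show "comm_monoid (poly_ring M)"
    by (rule comm_monoidI) (simp_all add: carrier_poly_ring_1 carrier_poly_ring_mult algebra_simps)
qed (simp add: algebra_simps)

lemma minus_poly_ring:
  assumes "p \<in> carrier (poly_ring M)" "q \<in> carrier (poly_ring M)"
  shows "p \<ominus>\<^bsub>poly_ring M\<^esub> q = p - q"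
proof -
  interpret cring "poly_ring M" by (rule cring_poly_ring)
  have "\<ominus>\<^bsub>poly_ring M\<^esub> q = - q"
    by (rule minus_equality) (simp_all add: assms carrier_poly_ring_uminus)
  then show ?thesis by (simp add: a_minus_def)
qed

lemma finprod_poly_ring:
  assumes "\<And>i. i \<in> A \<Longrightarrow> f i \<in> carrier (poly_ring M)"
  shows "finprod (poly_ring M) f A = prod f A"
proof -
  interpret cring "poly_ring M" by (rule cring_poly_ring)
  show ?thesis
    using assms by (induction A rule: infinite_finite_induct) (simp_all add: Pi_def)
qed

lemma nat_pow_poly_ring: "p [^]\<^bsub>poly_ring M\<^esub> (n :: nat) = p ^ n"
  by (induction n) (simp_all add: mult.commute)

lemma gens_subset:
  "incomparable_gens M \<subseteq> carrier (poly_ring M)" "linear_gens M \<subseteq> carrier (poly_ring M)"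
proof -
  show "incomparable_gens M \<subseteq> carrier (poly_ring M)"
    by (auto simp: incomparable_gens_def intro!: carrier_poly_ring_mult carrier_poly_ring_var)
  show "linear_gens M \<subseteq> carrier (poly_ring M)"
    by (auto simp: linear_gens_def
        intro!: carrier_poly_ring_diff carrier_poly_ring_sum carrier_poly_ring_var)
qed

lemma ideal_chow_ideal: "ideal (chow_ideal M) (poly_ring M)"
proof -
  interpret cring "poly_ring M" by (rule cring_poly_ring)
  show ?thesis unfolding chow_ideal_def
    by (intro add_ideals genideal_ideal gens_subset)
qed

lemma gens_in_chow_ideal: "incomparable_gens M \<subseteq> chow_ideal M" "linear_gens M \<subseteq> chow_ideal M"
proof -
  interpret cring "poly_ring M" by (rule cring_poly_ring)
  let ?I = "Idl\<^bsub>poly_ring M\<^esub> (incomparable_gens M)" and ?J = "Idl\<^bsub>poly_ring M\<^esub> (linear_gens M)"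
  have 0: "0 \<in> ?I" "0 \<in> ?J"
    using additive_subgroup.zero_closed[OF ideal.axioms(1)[OF genideal_ideal[OF gens_subset(1)]]]
      additive_subgroup.zero_closed[OF ideal.axioms(1)[OF genideal_ideal[OF gens_subset(2)]]] by simp_all
  have sum: "chow_ideal M = {i + j | i j. i \<in> ?I \<and> j \<in> ?J}"
    unfolding chow_ideal_def set_add_def' by auto
  show "incomparable_gens M \<subseteq> chow_ideal M"
  proof
    fix f assume "f \<in> incomparable_gens M"
    then have "f \<in> ?I" using genideal_self[OF gens_subset(1)] by blast
    then show "f \<in> chow_ideal M" unfolding sum using 0 by (intro CollectI exI[of _ f] exI[of _ 0]) simp
  qed
  show "linear_gens M \<subseteq> chow_ideal M"
  proof
    fix f assume "f \<in> linear_gens M"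
    then have "f \<in> ?J" using genideal_self[OF gens_subset(2)] by blast
    then show "f \<in> chow_ideal M" unfolding sum using 0 by (intro CollectI exI[of _ 0] exI[of _ f]) simp
  qed
qed

text \<open>Makes the abstract calculus available for polynomials in the variables of the proper
  flats, where \<open>ceq {}\<close> is congruence modulo the Chow ideal.\<close>

lemma chow_relations_var:
  assumes "matroid M"
  shows "chow_relations M var (carrier (poly_ring M)) (chow_ideal M)"
proof -
  interpret matroid M by fact
  interpret R: cring "poly_ring M" by (rule cring_poly_ring)
  interpret I: ideal "chow_ideal M" "poly_ring M" by (rule ideal_chow_ideal)
  show ?thesis
  proof
    fix F G assume "F \<in> proper_flats M" "G \<in> proper_flats M" "\<not> F \<subseteq> G" "\<not> G \<subseteq> F"
    then have "var F * var G \<in> incomparable_gens M" unfolding incomparable_gens_def by blast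
    then show "var F * var G \<in> chow_ideal M" using gens_in_chow_ideal by blast
  next
    fix i j assume "i \<in> ground M" "j \<in> ground M"
    then show "(\<Sum>G\<in>{G \<in> proper_flats M. i \<in> G}. var G) - (\<Sum>G\<in>{G \<in> proper_flats M. j \<in> G}. var G) \<in> chow_ideal M"
      using gens_in_chow_ideal(2)[of M] by (auto simp: linear_gens_def)
  next
    show "u + v \<in> chow_ideal M" if "u \<in> chow_ideal M" "v \<in> chow_ideal M" for u v
      using I.a_closed[OF that] by simp
    show "u * v \<in> chow_ideal M" if "u \<in> carrier (poly_ring M)" "v \<in> chow_ideal M" for u v
      using I.I_l_closed[OF that(2,1)] by simp
    show "0 \<in> chow_ideal M" using I.zero_closed by simp
  qed (auto intro: carrier_poly_ring_0 carrier_poly_ring_1 carrier_poly_ring_add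
      carrier_poly_ring_mult carrier_poly_ring_uminus carrier_poly_ring_var)
qed

lemma chow_class_hom: "ring_hom_cring (poly_ring M) (chow_ring M) (chow_class M)"
proof -
  have "chow_class M = (+>\<^bsub>poly_ring M\<^esub>) (chow_ideal M)" by (simp add: chow_class_def fun_eq_iff)
  then show ?thesis
    unfolding chow_ring_def using ideal.rcos_ring_hom_cring[OF ideal_chow_ideal cring_poly_ring] by simp
qed

lemma chow_class_eqI:
  assumes "p \<in> carrier (poly_ring M)" "q \<in> carrier (poly_ring M)" "p - q \<in> chow_ideal M"
  shows "chow_class M p = chow_class M q"
proof -
  interpret cring "poly_ring M" by (rule cring_poly_ring)
  show ?thesis
    using quotient_eq_iff_same_a_r_cos[OF ideal_chow_ideal assms(1,2)] assms
    by (simp add: chow_class_def minus_poly_ring)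
qed

lemma chow_class_prod:
  assumes "\<And>i. i \<in> A \<Longrightarrow> f i \<in> carrier (poly_ring M)"
  shows "finprod (chow_ring M) (\<lambda>i. chow_class M (f i)) A = chow_class M (prod f A)"
proof -
  interpret ring_hom_cring "poly_ring M" "chow_ring M" "chow_class M" by (rule chow_class_hom)
  show ?thesis
    using hom_finprod[of f A] assms finprod_poly_ring[of A f M] by (simp add: Pi_def o_def)
qed

lemma chow_class_power:
  assumes "p \<in> carrier (poly_ring M)"
  shows "chow_class M p [^]\<^bsub>chow_ring M\<^esub> (n :: nat) = chow_class M (p ^ n)"
proof -
  interpret ring_hom_cring "poly_ring M" "chow_ring M" "chow_class M" by (rule chow_class_hom)
  show ?thesis
  proof (induction n)
    case (Suc n)
    have "p ^ n \<in> carrier (poly_ring M)"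
      using R.nat_pow_closed[OF assms] by (simp add: nat_pow_poly_ring)
    then show ?case using Suc hom_mult[of "p ^ n" p] assms by (simp add: mult.commute)
  qed (use hom_one in simp)
qed


section \<open>Homogeneity and the degree of a multiple of a full flag\<close>

lemma homogeneous_mult:
  assumes "homogeneous a p" "homogeneous b q"
  shows "homogeneous (a + b) (p * q)"
  unfolding homogeneous_def
proof
  fix m assume "m \<in> Poly_Mapping.keys (p * q)"
  then obtain m1 m2 where m: "m = m1 + m2" "m1 \<in> Poly_Mapping.keys p" "m2 \<in> Poly_Mapping.keys q"
    using keys_mult[of p q] by blast
  then show "(\<Sum>F\<in>Poly_Mapping.keys m. Poly_Mapping.lookup m F) = a + b"
    using assms setsum_keys_plus_distrib[of "\<lambda>_ n. n" m1 m2] by (simp add: homogeneous_def)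
qed

lemma homogeneous_prod_var: "finite A \<Longrightarrow> homogeneous (card A) (\<Prod>i\<in>A. var (G i))"
proof (induction A rule: finite_induct)
  case empty
  then show ?case by (simp add: homogeneous_def)
next
  case (insert i A)
  have "homogeneous 1 (var (G i))" by (simp add: homogeneous_def var_def)
  then show ?case using insert homogeneous_mult[of 1 "var (G i)"] by fastforce
qed

lemma degree_of_flag:
  assumes deg: "is_degree_map M deg" and rank: "matroid_rank M = d + 1"
    and G: "\<And>m. m \<in> {1..d} \<Longrightarrow> G m \<in> proper_flats M" "\<And>m. m \<in> {1..<d} \<Longrightarrow> G m \<subset> G (m + 1)"
  shows "deg (chow_class M (of_int z * (\<Prod>m = 1..d. var (G m)))) = of_int z"
proof -
  interpret ring_hom_cring "poly_ring M" "chow_ring M" "chow_class M" by (rule chow_class_hom)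
  let ?p = "\<Prod>m = 1..d. var (G m)"
  have var_G: "var (G m) \<in> carrier (poly_ring M)" if "m \<in> {1..d}" for m
    using G(1)[OF that] by (rule carrier_poly_ring_var)
  have p: "?p \<in> carrier (poly_ring M)" by (rule carrier_poly_ring_prod[OF var_G])
  \<comment> \<open>Linearity of \<open>deg\<close> is available on the top graded piece only, so
    the flag has to be placed there first.\<close>
  have "homogeneous d ?p" using homogeneous_prod_var[of "{1..d}" G] by simp
  then have graded: "chow_class M ?p \<in> chow_graded M d" using p by (auto simp: chow_graded_def)
  \<comment> \<open>Scalars act on the Chow ring through the classes of constant polynomials, so the
    integer factor has to be recognised as one.\<close>
  have "(of_int z :: 'a chow_poly) = const (of_int z)" by (simp add: const_def)
  then have "chow_class M (of_int z * ?p) = chow_class M (const (of_int z)) \<otimes>\<^bsub>chow_ring M\<^esub> chow_class M ?p"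
    using hom_mult[OF carrier_poly_ring_const p] by simp
  then have "deg (chow_class M (of_int z * ?p)) = of_int z * deg (chow_class M ?p)"
    using deg graded rank by (simp add: is_degree_map_def Let_def)
  moreover have "deg (\<Otimes>\<^bsub>chow_ring M\<^esub>m\<in>{1..d}. chow_var M (G m)) = 1"
    using deg rank G unfolding is_degree_map_def Let_def by simp
  then have "deg (chow_class M ?p) = 1"
    using chow_class_prod[of "{1..d}" "\<lambda>m. var (G m)" M] var_G by simp
  ultimately show ?thesis by simp
qed

theorem theorem3p2:
  fixes M :: "'a matroid_data"
    and deg :: "'a chow_poly set \<Rightarrow> real"
    and F :: "nat \<Rightarrow> 'a set"
    and e :: "nat \<Rightarrow> nat"
    and d k :: nat
  assumes "matroid M"
    and "loopless M"
    and "matroid_rank M = d + 1"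
    and "is_degree_map M deg"
    and "F 0 = {}"
    and "F (k + 1) = ground M"
    and "\<forall>i\<in>{0..k + 1}. F i \<in> flats M"
    and "\<forall>i\<in>{0..k}. F i \<subset> F (i + 1)"
    and "\<forall>i\<in>{1..k}. e i > 0"
    and "(\<Sum>i = 1..k. e i) = d"
  shows "deg (\<Otimes>\<^bsub>chow_ring M\<^esub>i\<in>{1..k}. chow_var M (F i) [^]\<^bsub>chow_ring M\<^esub> e i) =
    (-1) ^ (d - k) *
    (\<Prod>i = 1..k.
       real_of_int (binom (int (e i) - 1) (int (\<Sum>j = 1..i. e j) - int (rk M (F i)))) *
       real_of_int (unsigned_coeff (int (\<Sum>j = 1..i. e j) - int (rk M (F i)))
                      (minor M (F (i + 1)) (F i))))"
proof -
  interpret chow_relations M var "carrier (poly_ring M)" "chow_ideal M"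
    by (rule chow_relations_var) fact
  interpret H: ring_hom_cring "poly_ring M" "chow_ring M" "chow_class M" by (rule chow_class_hom)
  have rank: "rk M (ground M) = d + 1" using assms(3) by (simp add: matroid_rank_def)
  have flat: "F i \<in> flats M" if "i \<le> k + 1" for i using assms(7) that by simp
  have chain: "F i \<subset> F (i + 1)" if "i \<le> k" for i using assms(8) that by simp
  have pos: "e i > 0" if "i \<in> {1..k}" for i using assms(9) that by blast
  let ?K = "(- 1) ^ (d - k) *
     (\<Prod>i = 1..k. binom (int (e i) - 1) (int (\<Sum>j = 1..i. e j) - int (rk M (F i))) *
       unsigned_coeff (int (\<Sum>j = 1..i. e j) - int (rk M (F i))) (minor M (F (i + 1)) (F i)))"
  obtain G where G: "\<And>m. m \<in> {1..d} \<Longrightarrow> G m \<in> proper_flats M"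
      "\<And>m. m \<in> {1..<d} \<Longrightarrow> G m \<subset> G (m + 1)"
      "ceq {} (\<Prod>i = 1..k. var (F i) ^ e i) (of_int ?K * (\<Prod>m = 1..d. var (G m)))"
    by (rule chain_monomial_flag[where F = F and e = e and k = k, OF rank assms(5,6) _ _ _ assms(10)])
      (erule flat chain pos | rule that; assumption)+
  have proper: "var (F i) \<in> carrier (poly_ring M)" if "i \<in> {1..k}" for i
    by (rule carrier_poly_ring_var,
        rule F_proper[where F = F and e = e and k = k, OF rank assms(5,6) _ _ _ assms(10)])
      (erule flat chain pos | rule that)+
  \<comment> \<open>Powers and products of cosets are pulled back to the coset of a single
    polynomial, to which the congruence \<open>G(3)\<close> applies.\<close>
  have "(\<Otimes>\<^bsub>chow_ring M\<^esub>i\<in>{1..k}. chow_var M (F i) [^]\<^bsub>chow_ring M\<^esub> e i)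
      = (\<Otimes>\<^bsub>chow_ring M\<^esub>i\<in>{1..k}. chow_class M (var (F i) ^ e i))"
    by (rule H.S.finprod_cong')
      (use proper in \<open>auto simp: chow_class_power intro!: C_power H.hom_closed\<close>)
  also have "\<dots> = chow_class M (\<Prod>i = 1..k. var (F i) ^ e i)"
    by (rule chow_class_prod) (use proper C_power in auto)
  also have "\<dots> = chow_class M (of_int ?K * (\<Prod>m = 1..d. var (G m)))"
    using G(3) by (intro chow_class_eqI) (auto simp: ceq_def)
  finally show ?thesis
    using degree_of_flag[where G = G and z = ?K, OF assms(4,3) G(1,2)] by simp
qed

end
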